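(* Let $G$ be a nontrivial orderable group with Property (T). Then, for every finite, symmetric generating subset $S\subset G$, $$\kappa(G,S)\leq\Phi^{-1}(|S|),$$ where $\Phi^{-1}:[1,\infty)\to[0,\sqrt{2})$ is the inverse of the bijection $\Phi:[0,\sqrt{2})\to[1,\infty)$, $\Phi(t)=\max\left\{e^{2t},4(2-t^2)^{-2}\right\}$.
   Context: A group $G$ is (left) orderable if there is a total order $\prec$ on $G$ such that $g\prec f$ implies $hg\prec hf$ for all $f,g,h\in G$. A subset $S\subset G$ is symmetric if $S=S^{-1}$. Groups with Property (T) are finitely generated discrete groups. For a finite subset $S\subset G$ and $\varepsilon\geq 0$, $(S,\varepsilon)$ is a Kazhdan pair for $G$ if, for every unitary representation $\pi$ of $G$ on a complex Hilbert space $\mathcal{H}$ without nonzero $G$-invariant vectors, $\max_{g\in S}\|\pi(g)\xi-\xi\|\geq\varepsilon\|\xi\|$ for all $\xi\in\mathcal{H}$. A finitely generated group $G$ has Property (T) if for every finite generating set $S$ there is $\varepsilon>0$ such that $(S,\varepsilon)$ is a Kazhdan pair for $G$. The Kazhdan constant is $\kappa(G,S)=\sup\{\varepsilon\geq 0:(S,\varepsilon)\text{ is a Kazhdan pair for }G\}$. Explicitly, $\Phi^{-1}(t)=\min\left\{\tfrac{1}{2}\log(t),\sqrt{2}\left(1-t^{-1/2}\right)^{1/2}\right\}$ for $t\in[1,\infty)$. *)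

theory Defs
  imports
    "HOL-Analysis.Analysis"
    "HOL-Algebra.Module"
    "HOL-Algebra.Generated_Groups"
    "HOL-Algebra.Group_Action"
begin

section \<open>Complex Hilbert spaces\<close>

definition complex_field :: "complex ring" where
  "complex_field =
     \<lparr>carrier = UNIV, monoid.mult = (*), one = 1, ring.zero = 0, add = (+)\<rparr>"

lemma complex_field_simps [simp]:
  "carrier complex_field = UNIV"
  "a \<otimes>\<^bsub>complex_field\<^esub> b = a * b"
  "\<one>\<^bsub>complex_field\<^esub> = 1"
  "\<zero>\<^bsub>complex_field\<^esub> = 0"
  "a \<oplus>\<^bsub>complex_field\<^esub> b = a + b"
  by (simp_all add: complex_field_def)

lemma cring_complex_field: "cring complex_field"
proof -
  have "\<exists>y. x + y = 0" for x :: complex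
    using add.right_inverse by blast
  then show ?thesis
    unfolding complex_field_def using add.right_inverse
    by unfold_locales (auto simp: algebra_simps Units_def)
qed

text \<open>
  As for every \<open>module\<close> record, the fields \<open>mult\<close> and \<open>one\<close> inherited from \<open>ring\<close> are unused.
\<close>

record 'h hilbert = "(complex, 'h) module" +
  ip :: "'h \<Rightarrow> 'h \<Rightarrow> complex"

definition hnorm :: "('h, 'c) hilbert_scheme \<Rightarrow> 'h \<Rightarrow> real" where
  "hnorm H x = sqrt (Re (ip H x x))"

locale complex_hilbert_space = Module.module complex_field H for H (structure) +
  assumes ip_add_right:
      "\<lbrakk>x \<in> carrier H; y \<in> carrier H; z \<in> carrier H\<rbrakk> \<Longrightarrow> ip H x (y \<oplus> z) = ip H x y + ip H x z"
    and ip_smult_right: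
      "\<lbrakk>x \<in> carrier H; y \<in> carrier H\<rbrakk> \<Longrightarrow> ip H x (c \<odot> y) = c * ip H x y"
    and ip_commute:
      "\<lbrakk>x \<in> carrier H; y \<in> carrier H\<rbrakk> \<Longrightarrow> ip H y x = cnj (ip H x y)"
    and ip_nonneg:
      "x \<in> carrier H \<Longrightarrow> 0 \<le> Re (ip H x x)"
    and ip_definite:
      "\<lbrakk>x \<in> carrier H; ip H x x = 0\<rbrakk> \<Longrightarrow> x = \<zero>"
    and complete:
      "\<lbrakk>\<And>n. X n \<in> carrier H;
        \<And>e. e > 0 \<Longrightarrow> \<exists>N. \<forall>m\<ge>N. \<forall>n\<ge>N. hnorm H (X m \<ominus> X n) < e\<rbrakk>
       \<Longrightarrow> \<exists>x\<in>carrier H. (\<lambda>n. hnorm H (X n \<ominus> x)) \<longlonglongrightarrow> 0"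


section \<open>Unitary representations\<close>

text \<open>
  \<open>group_action G (carrier H) \<pi>\<close> says that \<open>\<pi>\<close> is a homomorphism from \<open>G\<close> to the group of
  bijections of the carrier, so each \<open>\<pi> g\<close> below is a surjective linear isometry.
\<close>

locale unitary_rep =
  Group.group G + H: complex_hilbert_space H + group_action G "carrier H" \<pi>
  for G :: "('g, 'b) monoid_scheme" and H :: "'h hilbert" and \<pi> :: "'g \<Rightarrow> 'h \<Rightarrow> 'h" +
  assumes rep_add:
      "\<lbrakk>g \<in> carrier G; x \<in> carrier H; y \<in> carrier H\<rbrakk>
       \<Longrightarrow> \<pi> g (x \<oplus>\<^bsub>H\<^esub> y) = \<pi> g x \<oplus>\<^bsub>H\<^esub> \<pi> g y"
    and rep_smult:
      "\<lbrakk>g \<in> carrier G; x \<in> carrier H\<rbrakk> \<Longrightarrow> \<pi> g (c \<odot>\<^bsub>H\<^esub> x) = c \<odot>\<^bsub>H\<^esub> \<pi> g x"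
    and rep_ip:
      "\<lbrakk>g \<in> carrier G; x \<in> carrier H; y \<in> carrier H\<rbrakk> \<Longrightarrow> ip H (\<pi> g x) (\<pi> g y) = ip H x y"

definition has_invariant_vector ::
    "('g, 'b) monoid_scheme \<Rightarrow> 'h hilbert \<Rightarrow> ('g \<Rightarrow> 'h \<Rightarrow> 'h) \<Rightarrow> bool" where
  "has_invariant_vector G H \<pi> \<longleftrightarrow>
     (\<exists>v\<in>carrier H. v \<noteq> \<zero>\<^bsub>H\<^esub> \<and> (\<forall>g\<in>carrier G. \<pi> g v = v))"


section \<open>Kazhdan pairs, Property (T), Kazhdan constants\<close>

text \<open>
  HOL cannot quantify over all types inside a formula, so \<open>kazhdan_pair_in TYPE('h)\<close> ranges over
  the Hilbert spaces whose underlying set is a subset of \<open>'h\<close>.  The type \<open>'g \<Rightarrow> complex\<close> used in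
  \<open>kazhdan_pair\<close> is large enough: every vector \<open>\<xi>\<close> of a unitary representation \<open>(H, \<pi>)\<close> of \<open>G\<close>
  lies in a closed invariant subspace that embeds into \<open>'g \<Rightarrow> complex\<close> by mapping \<open>\<eta>\<close> to
  \<open>\<lambda>g. ip H (\<pi> g \<xi>) \<eta>\<close>.  See the theorem \<open>kazhdan_pair_universal\<close> below.

  Inserting \<open>0\<close> under the maximum of these nonnegative numbers only matters for \<open>S = {}\<close>.
\<close>

definition kazhdan_pair_in ::
    "'h itself \<Rightarrow> ('g, 'b) monoid_scheme \<Rightarrow> 'g set \<Rightarrow> real \<Rightarrow> bool" where
  "kazhdan_pair_in _ G S \<epsilon> \<longleftrightarrow>
     finite S \<and> S \<subseteq> carrier G \<and> \<epsilon> \<ge> 0 \<and>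
     (\<forall>(H :: 'h hilbert) \<pi>. unitary_rep G H \<pi> \<and> \<not> has_invariant_vector G H \<pi> \<longrightarrow>
        (\<forall>\<xi>\<in>carrier H.
           Max (insert 0 ((\<lambda>g. hnorm H (\<pi> g \<xi> \<ominus>\<^bsub>H\<^esub> \<xi>)) ` S)) \<ge> \<epsilon> * hnorm H \<xi>))"

definition kazhdan_pair :: "('g, 'b) monoid_scheme \<Rightarrow> 'g set \<Rightarrow> real \<Rightarrow> bool" where
  "kazhdan_pair = kazhdan_pair_in TYPE('g \<Rightarrow> complex)"

definition generating_set :: "('g, 'b) monoid_scheme \<Rightarrow> 'g set \<Rightarrow> bool" where
  "generating_set G S \<longleftrightarrow> S \<subseteq> carrier G \<and> generate G S = carrier G"

definition property_T :: "('g, 'b) monoid_scheme \<Rightarrow> bool" where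
  "property_T G \<longleftrightarrow>
     (\<exists>S. finite S \<and> generating_set G S) \<and>
     (\<forall>S. finite S \<and> generating_set G S \<longrightarrow> (\<exists>\<epsilon>>0. kazhdan_pair G S \<epsilon>))"

text \<open>
  The supremum is taken in the extended reals because the set is unbounded for the trivial group.
\<close>

definition kazhdan_const :: "('g, 'b) monoid_scheme \<Rightarrow> 'g set \<Rightarrow> ereal" where
  "kazhdan_const G S = Sup {ereal \<epsilon> | \<epsilon>. \<epsilon> \<ge> 0 \<and> kazhdan_pair G S \<epsilon>}"


section \<open>Orderable groups\<close>

definition orderable_group :: "('g, 'b) monoid_scheme \<Rightarrow> bool" where
  "orderable_group G \<longleftrightarrow> Group.group G \<and>
     (\<exists>r. strict_linear_order_on (carrier G) r \<and>
        (\<forall>f\<in>carrier G. \<forall>g\<in>carrier G. \<forall>h\<in>carrier G.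
           (g, f) \<in> r \<longrightarrow> (h \<otimes>\<^bsub>G\<^esub> g, h \<otimes>\<^bsub>G\<^esub> f) \<in> r))"

definition symmetric_subset :: "('g, 'b) monoid_scheme \<Rightarrow> 'g set \<Rightarrow> bool" where
  "symmetric_subset G S \<longleftrightarrow> S = set_inv\<^bsub>G\<^esub> S"


section \<open>The function \<open>\<Phi>\<close> and its inverse\<close>

definition Phi :: "real \<Rightarrow> real" where
  "Phi t = max (exp (2 * t)) (4 / (2 - t\<^sup>2)\<^sup>2)"

definition Phi_inv :: "real \<Rightarrow> real" where
  "Phi_inv = inv_into {0..<sqrt 2} Phi"

lemma Phi_strict_mono:
  assumes "0 \<le> s" "s < t" "t < sqrt 2"
  shows "Phi s < Phi t"
proof -
  have t2: "t\<^sup>2 < 2" "s\<^sup>2 < t\<^sup>2"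
    using assms real_sqrt_less_iff[of "t\<^sup>2" 2] by (auto intro!: power_strict_mono)
  have "exp (2 * s) < exp (2 * t)"
    using assms by simp
  moreover have "(2 - t\<^sup>2)\<^sup>2 < (2 - s\<^sup>2)\<^sup>2"
    using t2 by (intro power_strict_mono) auto
  then have "4 / (2 - s\<^sup>2)\<^sup>2 < 4 / (2 - t\<^sup>2)\<^sup>2"
    using t2 by (intro divide_strict_left_mono) auto
  ultimately show ?thesis
    unfolding Phi_def by linarith
qed

lemma Phi_ge_1: "0 \<le> t \<Longrightarrow> 1 \<le> Phi t"
  by (simp add: Phi_def le_max_iff_disj)

lemma Phi_explicit_inverse:
  assumes "1 \<le> s"
  defines "t \<equiv> min (ln s / 2) (sqrt 2 * sqrt (1 - s powr (-1/2)))"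
  shows "t \<in> {0..<sqrt 2}" "Phi t = s"
proof -
  define a where "a = ln s / 2"
  define b where "b = sqrt 2 * sqrt (1 - s powr (-1/2))"
  have t: "t = min a b" by (simp add: t_def a_def b_def)
  have p: "0 < s powr (-1/2)" "s powr (-1/2) \<le> 1"
    using assms powr_mono[of "-1/2" 0 s] by auto
  have b0: "0 \<le> b" and b1: "b < sqrt 2"
    using p by (auto simp: b_def)
  have a0: "0 \<le> a" using assms by (simp add: a_def)
  show ts: "t \<in> {0..<sqrt 2}" using t b0 b1 a0 by auto
  have ea: "exp (2 * a) = s" using assms by (simp add: a_def)
  have "b\<^sup>2 = 2 * (1 - s powr (-1/2))"
    using p by (simp add: b_def power_mult_distrib)
  then have "(2 - b\<^sup>2)\<^sup>2 = 4 * (s powr (-1/2))\<^sup>2"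
    by (simp add: power2_eq_square)
  also have "(s powr (-1/2))\<^sup>2 = 1 / s"
    using assms by (simp add: power2_eq_square powr_minus_divide flip: powr_add)
  finally have eb: "4 / (2 - b\<^sup>2)\<^sup>2 = s" using assms by simp
  have ub: "4 / (2 - t\<^sup>2)\<^sup>2 \<le> s"
  proof -
    have "t\<^sup>2 \<le> b\<^sup>2" using t ts by (intro power_mono) auto
    moreover have "b\<^sup>2 < 2" using b0 b1 real_sqrt_less_iff[of "b\<^sup>2" 2] by auto
    ultimately have "(2 - b\<^sup>2)\<^sup>2 \<le> (2 - t\<^sup>2)\<^sup>2" "0 < (2 - b\<^sup>2)\<^sup>2"
      by (auto intro!: power_mono)
    then have "4 / (2 - t\<^sup>2)\<^sup>2 \<le> 4 / (2 - b\<^sup>2)\<^sup>2"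
      by (intro frac_le) simp_all
    then show ?thesis using eb by simp
  qed
  have ua: "exp (2 * t) \<le> s"
    using t ea by (metis exp_le_cancel_iff min.cobounded1 mult_le_cancel_left_pos zero_less_numeral)
  have "t = a \<or> t = b" using t by (auto simp: min_def)
  then show "Phi t = s"
    using ea eb ua ub unfolding Phi_def by (auto simp: max_def)
qed

lemma inj_on_Phi: "inj_on Phi {0..<sqrt 2}"
proof (rule inj_onI)
  fix x y assume "x \<in> {0..<sqrt 2}" "y \<in> {0..<sqrt 2}" "Phi x = Phi y"
  then show "x = y"
    using Phi_strict_mono[of x y] Phi_strict_mono[of y x] by (cases x y rule: linorder_cases) auto
qed

lemma bij_betw_Phi: "bij_betw Phi {0..<sqrt 2} {1..}"
  unfolding bij_betw_def
proof (intro conjI inj_on_Phi equalityI subsetI)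
  fix s :: real assume "s \<in> {1..}"
  then show "s \<in> Phi ` {0..<sqrt 2}"
    using Phi_explicit_inverse[of s] by (metis atLeast_iff image_eqI)
qed (auto simp: Phi_ge_1)

lemma Phi_inv_explicit:
  "1 \<le> s \<Longrightarrow> Phi_inv s = min (ln s / 2) (sqrt 2 * sqrt (1 - s powr (-1/2)))"
  unfolding Phi_inv_def
  using Phi_explicit_inverse[of s] inj_on_Phi by (metis inv_into_f_eq)


section \<open>Kazhdan pairs do not depend on the universe\<close>

context complex_hilbert_space
begin

lemma ip_zero_right [simp]: "x \<in> carrier H \<Longrightarrow> ip H x \<zero> = 0"
  using ip_add_right[of x \<zero> \<zero>] by simp

lemma ip_minus_right:
  assumes "x \<in> carrier H" "y \<in> carrier H"
  shows "ip H x (\<ominus> y) = - ip H x y"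
proof -
  have "ip H x (y \<oplus> \<ominus> y) = ip H x y + ip H x (\<ominus> y)"
    using assms by (intro ip_add_right) auto
  then show ?thesis
    using assms by (simp add: r_neg eq_neg_iff_add_eq_0 add.commute)
qed

lemma ip_diff_right:
  "\<lbrakk>x \<in> carrier H; y \<in> carrier H; z \<in> carrier H\<rbrakk> \<Longrightarrow> ip H x (y \<ominus> z) = ip H x y - ip H x z"
  by (simp add: a_minus_def ip_add_right ip_minus_right)

lemma ip_diff_left:
  "\<lbrakk>x \<in> carrier H; y \<in> carrier H; z \<in> carrier H\<rbrakk> \<Longrightarrow> ip H (y \<ominus> z) x = ip H y x - ip H z x"
  using ip_commute[of x "y \<ominus> z"] ip_commute[of x y] ip_commute[of x z]
  by (simp add: ip_diff_right)

lemma ip_smult_left: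
  "\<lbrakk>x \<in> carrier H; y \<in> carrier H\<rbrakk> \<Longrightarrow> ip H (c \<odot> y) x = cnj c * ip H y x"
  using ip_commute[of x "c \<odot> y"] ip_commute[of x y] by (simp add: ip_smult_right)

lemma ip_self: "x \<in> carrier H \<Longrightarrow> ip H x x = complex_of_real ((hnorm H x)\<^sup>2)"
  using ip_commute[of x x] ip_nonneg[of x]
  by (auto simp: hnorm_def complex_eq_iff)

lemma Cauchy_Schwarz:
  assumes x: "x \<in> carrier H" and y: "y \<in> carrier H"
  shows "cmod (ip H x y) \<le> hnorm H x * hnorm H y"
proof (cases "hnorm H x = 0")
  case True
  then have "x = \<zero>" using ip_definite[OF x] ip_self[OF x] by simp
  then have "ip H x y = 0" using ip_commute[of y x] x y by simp
  then show ?thesis using True by simp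
next
  case False
  have n0: "hnorm H x \<ge> 0" "hnorm H y \<ge> 0" using x y ip_nonneg by (auto simp: hnorm_def)
  define N where "N = (hnorm H x)\<^sup>2"
  have N: "N > 0" using False by (simp add: N_def)
  define w where "w = ip H x y"
  define c where "c = w / of_real N"
  define z where "z = y \<ominus> c \<odot> x"
  have z: "z \<in> carrier H" using x y by (simp add: z_def)
  have "ip H z z = (ip H y y - c * ip H y x) - cnj c * (ip H x y - c * ip H x x)"
    using x y by (simp add: z_def ip_diff_right ip_diff_left ip_smult_left ip_smult_right
        algebra_simps)
  also have "ip H y x = cnj w" using ip_commute[OF x y] by (simp add: w_def)
  also have "ip H x x = of_real N" using ip_self[OF x] by (simp add: N_def)
  also have "ip H x y - c * of_real N = 0" using N by (simp add: c_def w_def)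
  also have "c * cnj w = of_real ((cmod w)\<^sup>2 / N)"
    by (simp add: c_def complex_norm_square flip: of_real_power)
  also have "ip H y y = of_real ((hnorm H y)\<^sup>2)" using ip_self[OF y] .
  finally have "Re (ip H z z) = (hnorm H y)\<^sup>2 - (cmod w)\<^sup>2 / N"
    by simp
  then have "(cmod w)\<^sup>2 / N \<le> (hnorm H y)\<^sup>2" using ip_nonneg[OF z] by simp
  then have "(cmod w)\<^sup>2 \<le> (hnorm H x * hnorm H y)\<^sup>2"
    using N by (simp add: field_simps N_def)
  then show ?thesis
    unfolding w_def using n0 by (simp add: power2_le_iff_abs_le)
qed

text \<open>A closed subspace can be transported along any injection.\<close>

lemma transport:
  fixes T :: "'a \<Rightarrow> 'k"
  assumes K: "K \<subseteq> carrier H" and inj: "inj_on T K"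
    and K0: "\<zero> \<in> K"
    and Kadd: "\<And>x y. x \<in> K \<Longrightarrow> y \<in> K \<Longrightarrow> x \<oplus> y \<in> K"
    and Ksmult: "\<And>c x. x \<in> K \<Longrightarrow> c \<odot> x \<in> K"
    and Kclosed: "\<And>X x. (\<And>n. X n \<in> K) \<Longrightarrow> x \<in> carrier H \<Longrightarrow>
                    (\<lambda>n. hnorm H (X n \<ominus> x)) \<longlonglongrightarrow> 0 \<Longrightarrow> x \<in> K"
  defines "U \<equiv> inv_into K T"
  defines "L \<equiv> \<lparr>carrier = T ` K, monoid.mult = undefined, one = undefined, ring.zero = T \<zero>,
                add = (\<lambda>a b. T (U a \<oplus> U b)), smult = (\<lambda>c a. T (c \<odot> U a)),
                ip = (\<lambda>a b. ip H (U a) (U b))\<rparr>"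
  shows "complex_hilbert_space L"
    and "\<And>x. x \<in> K \<Longrightarrow> hnorm L (T x) = hnorm H x"
    and "\<And>x y. x \<in> K \<Longrightarrow> y \<in> K \<Longrightarrow> T x \<ominus>\<^bsub>L\<^esub> T y = T (x \<ominus> y)"
    and "\<And>x y. x \<in> K \<Longrightarrow> y \<in> K \<Longrightarrow> x \<ominus> y \<in> K"
proof -
  have UT [simp]: "U (T x) = x" if "x \<in> K" for x
    using inj that by (simp add: U_def)
  have KH: "x \<in> carrier H" if "x \<in> K" for x using K that by blast
  have Lc: "carrier L = T ` K" and L0: "\<zero>\<^bsub>L\<^esub> = T \<zero>"
    by (simp_all add: L_def)
  have Ladd: "T x \<oplus>\<^bsub>L\<^esub> T y = T (x \<oplus> y)" if "x \<in> K" "y \<in> K" for x y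
    using that by (simp add: L_def)
  have Lsm: "c \<odot>\<^bsub>L\<^esub> T x = T (c \<odot> x)" if "x \<in> K" for x c
    using that by (simp add: L_def)
  have Lip: "ip L (T x) (T y) = ip H x y" if "x \<in> K" "y \<in> K" for x y
    using that by (simp add: L_def)
  have Kneg: "\<ominus> x \<in> K" if "x \<in> K" for x
    using Ksmult[OF that, of "-1"] KH[OF that] smult_l_minus[of 1 x] smult_one[of x]
    by (metis (mono_tags, lifting) UNIV_I complex_field_simps add.right_inverse
        cring_complex_field abelian_group.minus_equality cring.axioms(1) ring.is_abelian_group
        abelian_group.minus_minus add.commute)
  have grp: "abelian_group L"
  proof (rule abelian_groupI)
    fix a assume "a \<in> carrier L"
    then obtain x where "x \<in> K" "a = T x" by (auto simp: Lc)
    then show "\<exists>b\<in>carrier L. b \<oplus>\<^bsub>L\<^esub> a = \<zero>\<^bsub>L\<^esub>"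
      using Kneg[of x] KH[of x] by (auto simp: Lc L0 Ladd l_neg intro!: bexI[of _ "\<ominus> x"])
  next
    fix a b assume "a \<in> carrier L" "b \<in> carrier L"
    then show "a \<oplus>\<^bsub>L\<^esub> b = b \<oplus>\<^bsub>L\<^esub> a"
      using a_comm KH by (auto simp: Lc Ladd)
  qed (auto simp: Lc L0 Ladd Kadd K0 KH a_assoc)
  have mod: "Module.module complex_field L"
    by (rule moduleI[OF cring_complex_field grp])
       (auto simp: Lc Lsm Ladd Ksmult Kadd KH smult_r_distr smult_assoc1[simplified]
             smult_l_distr[simplified] smult_one[simplified])
  interpret L: Module.module complex_field L by (rule mod)
  show Kdiff: "x \<ominus> y \<in> K" if "x \<in> K" "y \<in> K" for x y
    using that Kneg Kadd by (simp add: a_minus_def)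
  have Lneg: "\<ominus>\<^bsub>L\<^esub> T x = T (\<ominus> x)" if "x \<in> K" for x
    by (rule L.minus_equality) (use that Kneg KH in \<open>auto simp: Lc L0 Ladd l_neg\<close>)
  show Ldiff: "T x \<ominus>\<^bsub>L\<^esub> T y = T (x \<ominus> y)" if "x \<in> K" "y \<in> K" for x y
    using that Kneg by (simp add: a_minus_def Lneg Ladd)
  show Lnorm: "hnorm L (T x) = hnorm H x" if "x \<in> K" for x
    using that by (simp add: hnorm_def Lip)
  show "complex_hilbert_space L"
  proof (intro complex_hilbert_space.intro mod complex_hilbert_space_axioms.intro)
    fix X :: "nat \<Rightarrow> 'k"
    assume X: "\<And>n. X n \<in> carrier L"
      and C: "\<And>e. e > 0 \<Longrightarrow> \<exists>N. \<forall>m\<ge>N. \<forall>n\<ge>N. hnorm L (X m \<ominus>\<^bsub>L\<^esub> X n) < e"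
    define Y where "Y = (\<lambda>n. U (X n))"
    have Y: "Y n \<in> K" "X n = T (Y n)" for n
      using X[of n] by (auto simp: Lc Y_def)
    obtain x where x: "x \<in> carrier H" "(\<lambda>n. hnorm H (Y n \<ominus> x)) \<longlonglongrightarrow> 0"
      using complete[of Y] Y C KH by (auto simp: Ldiff Lnorm Kdiff)
    then have "x \<in> K" using Kclosed Y by blast
    then show "\<exists>x\<in>carrier L. (\<lambda>n. hnorm L (X n \<ominus>\<^bsub>L\<^esub> x)) \<longlonglongrightarrow> 0"
      using x Y by (auto simp: Lc Ldiff Lnorm Kdiff intro!: bexI[of _ "x"])
  next
    fix x y assume "x \<in> carrier L" "y \<in> carrier L"
    then obtain a b where ab: "a \<in> K" "x = T a" "b \<in> K" "y = T b"
      by (auto simp: Lc)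
    have "ip H b a = cnj (ip H a b)"
      by (rule ip_commute) (use ab KH in auto)
    then show "ip L y x = cnj (ip L x y)"
      using ab by (simp only: Lip)
  next
    fix x assume "x \<in> carrier L" "ip L x x = 0"
    then obtain a where a: "a \<in> K" "x = T a" "ip H a a = 0"
      by (auto simp: Lc Lip)
    then have "a = \<zero>" using ip_definite KH by blast
    then show "x = \<zero>\<^bsub>L\<^esub>" using a by (simp add: L0)
  qed (auto simp: Lc Lip Ladd Lsm Kadd Ksmult KH ip_add_right ip_smult_right ip_nonneg)
qed

end

theorem kazhdan_pair_universal:
  fixes G :: "('g, 'b) monoid_scheme"
  assumes "kazhdan_pair G S \<epsilon>"
  shows "kazhdan_pair_in TYPE('h) G S \<epsilon>"
proof -
  note kp = assms[unfolded kazhdan_pair_def kazhdan_pair_in_def]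
  have fin: "finite S" and SG: "S \<subseteq> carrier G" and e: "\<epsilon> \<ge> 0" using kp by auto
  have "Max (insert 0 ((\<lambda>g. hnorm H (\<pi> g \<xi> \<ominus>\<^bsub>H\<^esub> \<xi>)) ` S)) \<ge> \<epsilon> * hnorm H \<xi>"
    if rep: "unitary_rep G H \<pi>" and ninv: "\<not> has_invariant_vector G H \<pi>" and xi: "\<xi> \<in> carrier H"
    for H :: "'h hilbert" and \<pi> \<xi>
  proof -
    interpret unitary_rep G H \<pi> by (rule rep)
    have pc: "\<pi> g x \<in> carrier H" if "g \<in> carrier G" "x \<in> carrier H" for g x
      using element_image that by blast
    have p1: "\<pi> \<one>\<^bsub>G\<^esub> x = x" if "x \<in> carrier H" for x
      using that by (simp flip: id_eq_one)
    have pinv: "\<pi> g (\<pi> (inv\<^bsub>G\<^esub> g) x) = x" if "g \<in> carrier G" "x \<in> carrier H" for g x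
      using that composition_rule[of x g "inv\<^bsub>G\<^esub> g"] p1 by simp
    have adj: "ip H (\<pi> g x) y = ip H x (\<pi> (inv\<^bsub>G\<^esub> g) y)"
      if "g \<in> carrier G" "x \<in> carrier H" "y \<in> carrier H" for g x y
      using rep_ip[of g x "\<pi> (inv\<^bsub>G\<^esub> g) y"] that pinv[of g y] pc by simp
    define P where "P = {y \<in> carrier H. \<forall>g\<in>carrier G. ip H (\<pi> g \<xi>) y = 0}"
    define K where "K = {x \<in> carrier H. \<forall>y\<in>P. ip H y x = 0}"
    have KH: "K \<subseteq> carrier H" and PH: "P \<subseteq> carrier H" by (auto simp: K_def P_def)
    have Pinv: "\<pi> g y \<in> P" if "g \<in> carrier G" "y \<in> P" for g y
    proof -
      have y: "y \<in> carrier H" "\<And>h. h \<in> carrier G \<Longrightarrow> ip H (\<pi> h \<xi>) y = 0"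
        using that by (auto simp: P_def)
      have "ip H (\<pi> h \<xi>) (\<pi> g y) = 0" if h: "h \<in> carrier G" for h
      proof -
        have "ip H (\<pi> h \<xi>) (\<pi> g y) = ip H (\<pi> (inv\<^bsub>G\<^esub> g) (\<pi> h \<xi>)) y"
          using adj[of "inv\<^bsub>G\<^esub> g" "\<pi> h \<xi>" y] \<open>g \<in> carrier G\<close> h y xi pc by simp
        also have "\<dots> = ip H (\<pi> (inv\<^bsub>G\<^esub> g \<otimes>\<^bsub>G\<^esub> h) \<xi>) y"
          using composition_rule[of \<xi> "inv\<^bsub>G\<^esub> g" h] \<open>g \<in> carrier G\<close> h xi by simp
        also have "\<dots> = 0" using y(2) \<open>g \<in> carrier G\<close> h by simp
        finally show ?thesis .
      qed
      then show ?thesis using that pc y by (auto simp: P_def)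
    qed
    have Kinv: "\<pi> g x \<in> K" if "g \<in> carrier G" "x \<in> K" for g x
    proof -
      have "ip H y (\<pi> g x) = 0" if y: "y \<in> P" for y
        using adj[of "inv\<^bsub>G\<^esub> g" y x] Pinv[of "inv\<^bsub>G\<^esub> g" y] that y \<open>g \<in> carrier G\<close> \<open>x \<in> K\<close> PH
        by (auto simp: K_def)
      then show ?thesis using that pc by (auto simp: K_def)
    qed
    have xiK: "\<xi> \<in> K"
    proof -
      have "ip H y \<xi> = 0" if "y \<in> P" for y
      proof -
        have "ip H \<xi> y = 0" using that p1[OF xi] by (auto simp: P_def dest: bspec[of _ _ "\<one>\<^bsub>G\<^esub>"])
        then show ?thesis using H.ip_commute[of \<xi> y] that PH xi by auto
      qed
      then show ?thesis using xi by (auto simp: K_def)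
    qed
    define T where "T = (\<lambda>x g. ip H (\<pi> g \<xi>) x)"
    have K0: "\<zero>\<^bsub>H\<^esub> \<in> K" using PH by (auto simp: K_def)
    have Kadd: "x \<oplus>\<^bsub>H\<^esub> y \<in> K" if "x \<in> K" "y \<in> K" for x y
      using that PH by (auto simp: K_def H.ip_add_right subset_iff)
    have Ksm: "c \<odot>\<^bsub>H\<^esub> x \<in> K" if "x \<in> K" for c x
      using that PH by (auto simp: K_def H.ip_smult_right subset_iff)
    have Kcl: "x \<in> K" if X: "\<And>n. X n \<in> K" and x: "x \<in> carrier H"
      and lim: "(\<lambda>n. hnorm H (X n \<ominus>\<^bsub>H\<^esub> x)) \<longlonglongrightarrow> 0" for X x
    proof -
      have "ip H y x = 0" if y: "y \<in> P" for y
      proof -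
        have yH: "y \<in> carrier H" and XH: "\<And>n. X n \<in> carrier H" using y PH X KH by auto
        have b: "cmod (ip H y x) \<le> hnorm H y * hnorm H (X n \<ominus>\<^bsub>H\<^esub> x)" for n
        proof -
          have "ip H y (X n \<ominus>\<^bsub>H\<^esub> x) = - ip H y x"
            using H.ip_diff_right[OF yH XH x, of n] X[of n] y by (simp add: K_def)
          then show ?thesis
            using H.Cauchy_Schwarz[of y "X n \<ominus>\<^bsub>H\<^esub> x"] yH XH x by simp
        qed
        have "(\<lambda>n. hnorm H y * hnorm H (X n \<ominus>\<^bsub>H\<^esub> x)) \<longlonglongrightarrow> hnorm H y * 0"
          by (intro tendsto_intros lim)
        then have "cmod (ip H y x) \<le> hnorm H y * 0"
          using b by (intro LIMSEQ_le_const) auto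
        then show ?thesis by simp
      qed
      then show ?thesis using x by (auto simp: K_def)
    qed
    have Kdiff: "x \<ominus>\<^bsub>H\<^esub> y \<in> K" if "x \<in> K" "y \<in> K" for x y
      using that PH by (auto simp: K_def H.ip_diff_right subset_iff)
    have inj: "inj_on T K"
    proof (rule inj_onI)
      fix x y assume xy: "x \<in> K" "y \<in> K" "T x = T y"
      have xyH: "x \<in> carrier H" "y \<in> carrier H" using xy KH by auto
      have "x \<ominus>\<^bsub>H\<^esub> y \<in> P"
        using xy(3) xyH xi pc by (auto simp: P_def T_def fun_eq_iff H.ip_diff_right)
      then have "ip H (x \<ominus>\<^bsub>H\<^esub> y) (x \<ominus>\<^bsub>H\<^esub> y) = 0"
        using Kdiff[OF xy(1,2)] by (auto simp: K_def)
      then have "x \<ominus>\<^bsub>H\<^esub> y = \<zero>\<^bsub>H\<^esub>" using H.ip_definite xyH by simp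
      moreover have "x = (x \<ominus>\<^bsub>H\<^esub> y) \<oplus>\<^bsub>H\<^esub> y"
        using xyH by (simp add: a_minus_def H.a_assoc H.l_neg)
      ultimately show "x = y" using xyH by simp
    qed
    define U where "U = inv_into K T"
    define L :: "('g \<Rightarrow> complex) hilbert" where "L = \<lparr>carrier = T ` K, monoid.mult = undefined, one = undefined,
       ring.zero = T \<zero>\<^bsub>H\<^esub>, add = (\<lambda>a b. T (U a \<oplus>\<^bsub>H\<^esub> U b)), smult = (\<lambda>c a. T (c \<odot>\<^bsub>H\<^esub> U a)),
       ip = (\<lambda>a b. ip H (U a) (U b))\<rparr>"
    note transport = H.transport[OF KH inj K0, folded U_def, folded L_def]
    have L_hilbert: "complex_hilbert_space L"
      by (rule transport(1); fact Kadd Ksm Kcl)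
    have L_norm: "hnorm L (T x) = hnorm H x" if "x \<in> K" for x
      by (rule transport(2); fact Kadd Ksm Kcl that)
    have L_diff: "T x \<ominus>\<^bsub>L\<^esub> T y = T (x \<ominus>\<^bsub>H\<^esub> y)" if "x \<in> K" "y \<in> K" for x y
      by (rule transport(3); fact Kadd Ksm Kcl that)
    have UT [simp]: "U (T x) = x" if "x \<in> K" for x
      using inj that by (simp add: U_def)
    have Lc: "carrier L = T ` K" by (simp add: L_def)
    define \<rho> where "\<rho> = (\<lambda>g. \<lambda>a\<in>T ` K. T (\<pi> g (U a)))"
    have \<rho>T: "\<rho> g (T x) = T (\<pi> g x)" if "x \<in> K" for g x
      using that by (simp add: \<rho>_def)
    have \<rho>B: "\<rho> g \<in> Bij (T ` K)" if g: "g \<in> carrier G" for g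
    proof -
      have "bij_betw (\<rho> g) (T ` K) (T ` K)"
      proof (rule bij_betw_byWitness[where f' = "\<rho> (inv\<^bsub>G\<^esub> g)"])
        show "\<forall>a\<in>T ` K. \<rho> (inv\<^bsub>G\<^esub> g) (\<rho> g a) = a"
          using g KH Kinv pinv[of "inv\<^bsub>G\<^esub> g"] by (auto simp: \<rho>T)
        show "\<forall>a\<in>T ` K. \<rho> g (\<rho> (inv\<^bsub>G\<^esub> g) a) = a"
          using g KH Kinv pinv[of g] by (auto simp: \<rho>T)
      qed (use g Kinv in \<open>auto simp: \<rho>T\<close>)
      then show ?thesis by (simp add: Bij_def \<rho>_def)
    qed
    have act: "group_action G (carrier L) \<rho>"
      unfolding Lc
    proof (intro group_action.intro group_hom.intro group_hom_axioms.intro homI group_BijGroup)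
      show "Group.group G" by (rule is_group)
      show "\<rho> g \<in> carrier (BijGroup (T ` K))" if "g \<in> carrier G" for g
        using \<rho>B[OF that] by (simp add: BijGroup_def)
      show "\<rho> (g \<otimes>\<^bsub>G\<^esub> h) = \<rho> g \<otimes>\<^bsub>BijGroup (T ` K)\<^esub> \<rho> h"
        if g: "g \<in> carrier G" and h: "h \<in> carrier G" for g h
      proof -
        have "\<rho> (g \<otimes>\<^bsub>G\<^esub> h) = compose (T ` K) (\<rho> g) (\<rho> h)"
        proof (rule extensionalityI[where A = "T ` K"])
          show "\<rho> (g \<otimes>\<^bsub>G\<^esub> h) a = compose (T ` K) (\<rho> g) (\<rho> h) a" if "a \<in> T ` K" for a
            using that g h KH Kinv composition_rule[of _ g h] by (auto simp: compose_def \<rho>T)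
        qed (simp_all add: \<rho>_def)
        then show ?thesis using \<rho>B g h by (simp add: BijGroup_def)
      qed
    qed
    have Lrep: "unitary_rep G L \<rho>"
    proof (intro unitary_rep.intro is_group L_hilbert act unitary_rep_axioms.intro)
      fix g a b assume g: "g \<in> carrier G" and "a \<in> carrier L" "b \<in> carrier L"
      then obtain x y where xy: "x \<in> K" "a = T x" "y \<in> K" "b = T y" by (auto simp: Lc)
      show "\<rho> g (a \<oplus>\<^bsub>L\<^esub> b) = \<rho> g a \<oplus>\<^bsub>L\<^esub> \<rho> g b"
        using xy g Kinv Kadd rep_add KH by (auto simp: L_def \<rho>T subset_iff)
      show "ip L (\<rho> g a) (\<rho> g b) = ip L a b"
        using xy g Kinv rep_ip KH by (auto simp: L_def \<rho>T subset_iff)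
    next
      fix g a c assume g: "g \<in> carrier G" and "a \<in> carrier L"
      then obtain x where xy: "x \<in> K" "a = T x" by (auto simp: Lc)
      show "\<rho> g (c \<odot>\<^bsub>L\<^esub> a) = c \<odot>\<^bsub>L\<^esub> \<rho> g a"
        using xy g Kinv Ksm rep_smult KH by (auto simp: L_def \<rho>T subset_iff)
    qed
    have Lninv: "\<not> has_invariant_vector G L \<rho>"
    proof
      assume "has_invariant_vector G L \<rho>"
      then obtain x where x: "x \<in> K" "T x \<noteq> T \<zero>\<^bsub>H\<^esub>" "\<And>g. g \<in> carrier G \<Longrightarrow> \<rho> g (T x) = T x"
        by (auto simp: has_invariant_vector_def L_def)
      have "\<pi> g x = x" if "g \<in> carrier G" for g
        using x(3)[OF that] x(1) Kinv[OF that x(1)] inj by (auto simp: \<rho>T inj_on_def)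
      then have "has_invariant_vector G H \<pi>"
        unfolding has_invariant_vector_def
        using x KH by (intro bexI[of _ x] conjI ballI) auto
      then show False using ninv by blast
    qed
    have "Max (insert 0 ((\<lambda>g. hnorm L (\<rho> g (T \<xi>) \<ominus>\<^bsub>L\<^esub> T \<xi>)) ` S)) \<ge> \<epsilon> * hnorm L (T \<xi>)"
      using kp Lrep Lninv xiK by (auto simp: Lc)
    moreover have "(\<lambda>g. hnorm L (\<rho> g (T \<xi>) \<ominus>\<^bsub>L\<^esub> T \<xi>)) ` S = (\<lambda>g. hnorm H (\<pi> g \<xi> \<ominus>\<^bsub>H\<^esub> \<xi>)) ` S"
    proof (rule image_cong[OF refl])
      fix g assume "g \<in> S"
      then have "\<pi> g \<xi> \<in> K" using SG Kinv xiK by auto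
      then show "hnorm L (\<rho> g (T \<xi>) \<ominus>\<^bsub>L\<^esub> T \<xi>) = hnorm H (\<pi> g \<xi> \<ominus>\<^bsub>H\<^esub> \<xi>)"
        using xiK Kdiff by (simp add: \<rho>T L_diff L_norm)
    qed
    ultimately show ?thesis using xiK by (simp add: L_norm)
  qed
  then show ?thesis
    using fin SG e unfolding kazhdan_pair_in_def by blast
qed

end

(*
  An orderable group with more than one element is infinite, so its left regular representation has
  no nonzero invariant vectors, and a vector in l2(G) that S moves by at most c times its norm
  bounds the Kazhdan constant by c.  Let n = |S|.

  For the bound sqrt (2 - 2 / sqrt n), take the value sqrt m at the identity and 1 on
  S - {1}, where m = |S - {1}|.

  For the bound (ln n) / 2, take lam > n and the vector lam powr (-|x| / 2), where |x| is the word
  length; it is square summable because at most n^k elements have length k.  A generator changes the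
  logarithm of the vector by at most c = (ln lam) / 2, so the pointwise inequality
  (u - v)^2 <= (ln u - ln v)^2 * (u^2 + v^2) / 2 and the invariance of the counting measure
  show that it moves the vector by at most c times its norm.  Then let lam tend to n.
*)
theory Submission
  imports Defs
begin

section \<open>The Hilbert space of square summable functions\<close>

text \<open>Vectors are total functions forced to be 0 outside \<open>A\<close>, so that equality of
  vectors is equality of functions. For \<open>A = carrier G\<close> they have the type over which
  \<open>kazhdan_pair\<close> quantifies.\<close>

definition l2_space :: "'a set \<Rightarrow> ('a \<Rightarrow> complex) hilbert" where
  "l2_space A =
     \<lparr>carrier = {f. (\<forall>x. x \<notin> A \<longrightarrow> f x = 0) \<and> (\<lambda>x. (cmod (f x))\<^sup>2) summable_on A},
      monoid.mult = undefined, one = undefined, ring.zero = (\<lambda>_. 0), add = (\<lambda>f g x. f x + g x),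
      smult = (\<lambda>c f x. c * f x), ip = (\<lambda>f g. \<Sum>\<^sub>\<infinity>x\<in>A. cnj (f x) * g x)\<rparr>"

lemma l2_space_simps [simp]:
  "carrier (l2_space A) = {f. (\<forall>x. x \<notin> A \<longrightarrow> f x = 0) \<and> (\<lambda>x. (cmod (f x))\<^sup>2) summable_on A}"
  "\<zero>\<^bsub>l2_space A\<^esub> = (\<lambda>_. 0)"
  "f \<oplus>\<^bsub>l2_space A\<^esub> g = (\<lambda>x. f x + g x)"
  "c \<odot>\<^bsub>l2_space A\<^esub> f = (\<lambda>x. c * f x)"
  "ip (l2_space A) f g = (\<Sum>\<^sub>\<infinity>x\<in>A. cnj (f x) * g x)"
  by (simp_all add: l2_space_def)

text \<open>A sum that does not converge has the value 0 by convention, so additivity of the inner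
  product depends on this convergence.\<close>

lemma summable_on_cnj_mult:
  fixes f g :: "'a \<Rightarrow> complex"
  assumes "(\<lambda>x. (cmod (f x))\<^sup>2) summable_on A" "(\<lambda>x. (cmod (g x))\<^sup>2) summable_on A"
  shows "(\<lambda>x. cnj (f x) * g x) summable_on A"
proof -
  have "(\<lambda>x. norm (cnj (f x) * g x)) summable_on A"
    by (rule abs_summable_product) (use assms in \<open>simp_all add: norm_mult power2_eq_square\<close>)
  then show ?thesis by (rule abs_summable_summable)
qed

lemma cmod_add_square_le: "(cmod (a + b))\<^sup>2 \<le> 2 * (cmod a)\<^sup>2 + 2 * (cmod b)\<^sup>2"
proof -
  have "(cmod (a + b))\<^sup>2 \<le> (cmod a + cmod b)\<^sup>2"
    by (intro power_mono norm_triangle_ineq norm_ge_zero)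
  then show ?thesis using sum_squares_bound[of "cmod a" "cmod b"] by (simp add: power2_sum)
qed

lemma summable_on_square_add:
  fixes f g :: "'a \<Rightarrow> complex"
  assumes "(\<lambda>x. (cmod (f x))\<^sup>2) summable_on A" "(\<lambda>x. (cmod (g x))\<^sup>2) summable_on A"
  shows "(\<lambda>x. (cmod (f x + g x))\<^sup>2) summable_on A"
proof (rule summable_on_comparison_test)
  show "(\<lambda>x. 2 * (cmod (f x))\<^sup>2 + 2 * (cmod (g x))\<^sup>2) summable_on A"
    using assms by (intro summable_on_add summable_on_cmult_right)
qed (auto simp: cmod_add_square_le)

lemma summable_on_square_smult:
  fixes f :: "'a \<Rightarrow> complex"
  assumes "(\<lambda>x. (cmod (f x))\<^sup>2) summable_on A"
  shows "(\<lambda>x. (cmod (c * f x))\<^sup>2) summable_on A"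
  using summable_on_cmult_right[OF assms, of "(cmod c)\<^sup>2"]
  by (simp add: norm_mult power_mult_distrib)

lemma abelian_group_l2_space: "abelian_group (l2_space A)"
proof (rule abelian_groupI)
  fix f assume "f \<in> carrier (l2_space A)"
  then show "\<exists>g\<in>carrier (l2_space A). g \<oplus>\<^bsub>l2_space A\<^esub> f = \<zero>\<^bsub>l2_space A\<^esub>"
    by (intro bexI[of _ "\<lambda>x. - f x"]) auto
qed (auto intro: summable_on_square_add simp: add_ac)

lemma module_l2_space: "Module.module complex_field (l2_space A)"
  by (rule moduleI[OF cring_complex_field abelian_group_l2_space])
     (auto intro: summable_on_square_add summable_on_square_smult simp: algebra_simps)

lemma l2_space_minus:
  assumes "f \<in> carrier (l2_space A)" "g \<in> carrier (l2_space A)"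
  shows "f \<ominus>\<^bsub>l2_space A\<^esub> g = (\<lambda>x. f x - g x)"
proof -
  interpret Module.module complex_field "l2_space A" by (rule module_l2_space)
  have "\<ominus>\<^bsub>l2_space A\<^esub> g = (\<lambda>x. - g x)"
    by (rule minus_equality) (use assms in auto)
  then show ?thesis by (simp add: a_minus_def)
qed

lemma ip_l2_space_self: "ip (l2_space A) f f = of_real (\<Sum>\<^sub>\<infinity>x\<in>A. (cmod (f x))\<^sup>2)"
proof -
  have "cnj z * z = of_real ((cmod z)\<^sup>2)" for z
    using complex_norm_square[of z] by (simp add: mult.commute)
  \<comment> \<open>The real and the complex family are summable together; if they are not, both
    sums are 0.\<close>
  moreover have "(\<Sum>\<^sub>\<infinity>x\<in>A. complex_of_real (h x)) = of_real (\<Sum>\<^sub>\<infinity>x\<in>A. h x)" for h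
    by (rule infsum_bounded_linear_strong[OF _ bounded_linear_of_real])
       (metis summable_on_Re Re_complex_of_real summable_on_cong summable_on_of_real)
  ultimately show ?thesis by (simp only: l2_space_simps)
qed

lemma hnorm_l2_space: "hnorm (l2_space A) f = sqrt (\<Sum>\<^sub>\<infinity>x\<in>A. (cmod (f x))\<^sup>2)"
  unfolding hnorm_def ip_l2_space_self by simp

text \<open>The Cauchy condition is restated for finite sums, where pointwise limits may be taken
  term by term. Uniformity in the finite set then gives the bound for the infinite sum.\<close>

lemma l2_space_complete:
  assumes X: "\<And>n. X n \<in> carrier (l2_space A)"
    and C: "\<And>e. e > 0 \<Longrightarrow> \<exists>N. \<forall>m\<ge>N. \<forall>n\<ge>N. hnorm (l2_space A) (X m \<ominus>\<^bsub>l2_space A\<^esub> X n) < e"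
  shows "\<exists>f\<in>carrier (l2_space A). (\<lambda>n. hnorm (l2_space A) (X n \<ominus>\<^bsub>l2_space A\<^esub> f)) \<longlonglongrightarrow> 0"
proof -
  interpret Module.module complex_field "l2_space A" by (rule module_l2_space)
  have sq: "(\<lambda>x. (cmod (X m x - X n x))\<^sup>2) summable_on A" for m n
    using minus_closed[OF X[of m] X[of n]] by (simp add: l2_space_minus[OF X X])
  have C2: "\<exists>N. \<forall>m n F. m \<ge> N \<longrightarrow> n \<ge> N \<longrightarrow> finite F \<longrightarrow> F \<subseteq> A \<longrightarrow>
      (\<Sum>x\<in>F. (cmod (X m x - X n x))\<^sup>2) \<le> e\<^sup>2"
    if e: "e > 0" for e
  proof -
    obtain N where N: "\<And>m n. m \<ge> N \<Longrightarrow> n \<ge> N \<Longrightarrow> hnorm (l2_space A) (X m \<ominus>\<^bsub>l2_space A\<^esub> X n) < e"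
      using C[OF e] by blast
    have "(\<Sum>x\<in>F. (cmod (X m x - X n x))\<^sup>2) \<le> e\<^sup>2"
      if "m \<ge> N" "n \<ge> N" "finite F" "F \<subseteq> A" for m n F
    proof -
      have "(\<Sum>x\<in>F. (cmod (X m x - X n x))\<^sup>2) \<le> (\<Sum>\<^sub>\<infinity>x\<in>A. (cmod (X m x - X n x))\<^sup>2)"
        using that sq by (intro finite_sum_le_infsum) auto
      also have "\<dots> \<le> e\<^sup>2"
        using N[OF that(1,2)] unfolding l2_space_minus[OF X X] hnorm_l2_space
        by (intro sqrt_le_D) simp
      finally show ?thesis .
    qed
    then show ?thesis by blast
  qed
  \<comment> \<open>A singleton \<open>F\<close> turns the bound on finite sums into a Cauchy
    condition at the point \<open>x\<close>; the value \<open>e/2\<close> leaves room for the strict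
    inequality.\<close>
  have "Cauchy (\<lambda>n. X n x)" if "x \<in> A" for x
  proof (rule metric_CauchyI)
    fix e :: real assume "e > 0"
    then obtain N where N: "\<And>m n F. m \<ge> N \<Longrightarrow> n \<ge> N \<Longrightarrow> finite F \<Longrightarrow> F \<subseteq> A \<Longrightarrow>
        (\<Sum>x\<in>F. (cmod (X m x - X n x))\<^sup>2) \<le> (e/2)\<^sup>2"
      using C2[OF half_gt_zero[OF \<open>e > 0\<close>]] by metis
    have "dist (X m x) (X n x) < e" if "m \<ge> N" "n \<ge> N" for m n
    proof -
      have "cmod (X m x - X n x) \<le> e/2"
        by (rule power2_le_imp_le) (use N[OF that, of "{x}"] \<open>x \<in> A\<close> \<open>e > 0\<close> in simp_all)
      then show ?thesis using \<open>e > 0\<close> by (simp add: dist_norm)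
    qed
    then show "\<exists>N. \<forall>m\<ge>N. \<forall>n\<ge>N. dist (X m x) (X n x) < e" by blast
  qed
  then have "\<exists>l. x \<in> A \<longrightarrow> (\<lambda>n. X n x) \<longlonglongrightarrow> l" for x
    using convergent_eq_Cauchy by blast
  then obtain f0 where f0: "\<And>x. x \<in> A \<Longrightarrow> (\<lambda>n. X n x) \<longlonglongrightarrow> f0 x" by metis
  define f where "f = (\<lambda>x. if x \<in> A then f0 x else 0)"
  have f: "(\<lambda>n. X n x) \<longlonglongrightarrow> f x" if "x \<in> A" for x
    using f0 that by (simp add: f_def)
  have B: "\<exists>N. \<forall>n F. n \<ge> N \<longrightarrow> finite F \<longrightarrow> F \<subseteq> A \<longrightarrow> (\<Sum>x\<in>F. (cmod (X n x - f x))\<^sup>2) \<le> e\<^sup>2"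
    if e: "e > 0" for e
  proof -
    obtain N where N: "\<And>m n F. m \<ge> N \<Longrightarrow> n \<ge> N \<Longrightarrow> finite F \<Longrightarrow> F \<subseteq> A \<Longrightarrow>
        (\<Sum>x\<in>F. (cmod (X m x - X n x))\<^sup>2) \<le> e\<^sup>2"
      using C2[OF e] by metis
    \<comment> \<open>Here \<open>n\<close> and \<open>F\<close> stay fixed while \<open>m\<close>
      tends to infinity; \<open>N\<close> was chosen before \<open>F\<close>.\<close>
    have "(\<Sum>x\<in>F. (cmod (X n x - f x))\<^sup>2) \<le> e\<^sup>2" if "n \<ge> N" "finite F" "F \<subseteq> A" for n F
    proof (rule LIMSEQ_le_const2)
      show "(\<lambda>m. \<Sum>x\<in>F. (cmod (X n x - X m x))\<^sup>2) \<longlonglongrightarrow> (\<Sum>x\<in>F. (cmod (X n x - f x))\<^sup>2)"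
        using that by (intro tendsto_intros f) auto
      show "\<exists>M. \<forall>m\<ge>M. (\<Sum>x\<in>F. (cmod (X n x - X m x))\<^sup>2) \<le> e\<^sup>2"
        using N that by blast
    qed
    then show ?thesis by blast
  qed
  have dsum: "(\<lambda>x. (cmod (X n x - f x))\<^sup>2) summable_on A"
    if "\<And>F. finite F \<Longrightarrow> F \<subseteq> A \<Longrightarrow> (\<Sum>x\<in>F. (cmod (X n x - f x))\<^sup>2) \<le> e\<^sup>2" for n and e :: real
    by (rule nonneg_bdd_above_summable_on[OF _ bdd_aboveI2[where M = "e\<^sup>2"]]) (use that in auto)
  \<comment> \<open>One index near the limit shows that \<open>f\<close> is square summable, through
    \<open>f = - (X N1 - f) + X N1\<close>.\<close>
  obtain N1 where N1: "\<forall>n F. n \<ge> N1 \<longrightarrow> finite F \<longrightarrow> F \<subseteq> A \<longrightarrow> (\<Sum>x\<in>F. (cmod (X n x - f x))\<^sup>2) \<le> 1\<^sup>2"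
    using B[OF zero_less_one] by (rule exE)
  have "(\<lambda>x. (cmod (- 1 * (X N1 x - f x)))\<^sup>2) summable_on A"
    by (intro summable_on_square_smult dsum[where e = 1]) (use N1 in blast)
  moreover have "(\<lambda>x. (cmod (X N1 x))\<^sup>2) summable_on A" using X[of N1] by simp
  ultimately have "(\<lambda>x. (cmod (- 1 * (X N1 x - f x) + X N1 x))\<^sup>2) summable_on A"
    by (rule summable_on_square_add)
  then have fA: "f \<in> carrier (l2_space A)" by (simp add: f_def)
  have "(\<lambda>n. hnorm (l2_space A) (X n \<ominus>\<^bsub>l2_space A\<^esub> f)) \<longlonglongrightarrow> 0"
  proof (rule LIMSEQ_I)
    fix e :: real assume e: "e > 0"
    obtain N where N: "\<And>n F. n \<ge> N \<Longrightarrow> finite F \<Longrightarrow> F \<subseteq> A \<Longrightarrow>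
        (\<Sum>x\<in>F. (cmod (X n x - f x))\<^sup>2) \<le> (e/2)\<^sup>2"
      using B[OF half_gt_zero[OF e]] by metis
    have "norm (hnorm (l2_space A) (X n \<ominus>\<^bsub>l2_space A\<^esub> f) - 0) < e" if n: "n \<ge> N" for n
    proof -
      have "(\<Sum>\<^sub>\<infinity>x\<in>A. (cmod (X n x - f x))\<^sup>2) \<le> (e/2)\<^sup>2"
        using N[OF n] by (intro infsum_le_finite_sums dsum[where e = "e/2"]) auto
      then have "sqrt (\<Sum>\<^sub>\<infinity>x\<in>A. (cmod (X n x - f x))\<^sup>2) \<le> e/2"
        using e by (intro real_le_lsqrt) auto
      moreover have "0 \<le> (\<Sum>\<^sub>\<infinity>x\<in>A. (cmod (X n x - f x))\<^sup>2)" by (simp add: infsum_nonneg)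
      ultimately show ?thesis
        unfolding l2_space_minus[OF X fA] hnorm_l2_space using e by simp
    qed
    then show "\<exists>N. \<forall>n\<ge>N. norm (hnorm (l2_space A) (X n \<ominus>\<^bsub>l2_space A\<^esub> f) - 0) < e" by blast
  qed
  then show ?thesis using fA by blast
qed

lemma complex_hilbert_space_l2_space: "complex_hilbert_space (l2_space A)"
proof (intro complex_hilbert_space.intro module_l2_space complex_hilbert_space_axioms.intro)
  fix f g h assume "f \<in> carrier (l2_space A)" "g \<in> carrier (l2_space A)" "h \<in> carrier (l2_space A)"
  then show "ip (l2_space A) f (g \<oplus>\<^bsub>l2_space A\<^esub> h) = ip (l2_space A) f g + ip (l2_space A) f h"
    by (simp add: distrib_left infsum_add summable_on_cnj_mult)
next
  fix f g c
  show "ip (l2_space A) f (c \<odot>\<^bsub>l2_space A\<^esub> g) = c * ip (l2_space A) f g"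
    by (simp add: mult.left_commute[of _ c] infsum_cmult_right')
next
  fix f g
  show "ip (l2_space A) g f = cnj (ip (l2_space A) f g)"
    by (simp add: mult.commute flip: infsum_cnj)
next
  fix f
  show "0 \<le> Re (ip (l2_space A) f f)"
    unfolding ip_l2_space_self by (simp add: infsum_nonneg)
next
  fix f assume f: "f \<in> carrier (l2_space A)" "ip (l2_space A) f f = 0"
  then have "(\<Sum>\<^sub>\<infinity>x\<in>A. (cmod (f x))\<^sup>2) = 0"
    unfolding ip_l2_space_self by (simp only: of_real_eq_0_iff)
  then have "(cmod (f x))\<^sup>2 = 0" if "x \<in> A" for x
    using that f by (intro nonneg_infsum_le_0D[of "\<lambda>x. (cmod (f x))\<^sup>2" A]) auto
  then show "f = \<zero>\<^bsub>l2_space A\<^esub>" using f by (auto simp: fun_eq_iff)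
qed (rule l2_space_complete)


section \<open>The left regular representation\<close>

context Group.group
begin

text \<open>Elements of \<open>BijGroup\<close> must be extensional, hence the restriction to the
  carrier of the Hilbert space; the value 0 outside \<open>carrier G\<close> keeps the result in
  \<open>l2_space\<close>.\<close>

definition left_regular :: "'a \<Rightarrow> ('a \<Rightarrow> complex) \<Rightarrow> 'a \<Rightarrow> complex" where
  "left_regular g =
     (\<lambda>f\<in>carrier (l2_space (carrier G)). \<lambda>x. if x \<in> carrier G then f (inv g \<otimes> x) else 0)"

text \<open>Reindexing along this bijection expresses the invariance of the counting measure;
  unitarity and both displacement estimates rest on it.\<close>

lemma left_mult_bij_betw: "g \<in> carrier G \<Longrightarrow> bij_betw (\<lambda>x. g \<otimes> x) (carrier G) (carrier G)"
  by (rule bij_betw_byWitness[where f' = "\<lambda>x. inv g \<otimes> x"]) (auto simp: m_assoc[symmetric])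

lemma left_regular_apply:
  "\<lbrakk>f \<in> carrier (l2_space (carrier G)); x \<in> carrier G\<rbrakk> \<Longrightarrow> left_regular g f x = f (inv g \<otimes> x)"
  by (simp add: left_regular_def)

lemma left_regular_outside:
  "\<lbrakk>f \<in> carrier (l2_space (carrier G)); x \<notin> carrier G\<rbrakk> \<Longrightarrow> left_regular g f x = 0"
  by (simp add: left_regular_def)

lemma left_regular_closed:
  assumes g: "g \<in> carrier G" and f: "f \<in> carrier (l2_space (carrier G))"
  shows "left_regular g f \<in> carrier (l2_space (carrier G))"
proof -
  have "(\<lambda>x. (cmod (f (inv g \<otimes> x)))\<^sup>2) summable_on carrier G"
    using f summable_on_reindex_bij_betw[OF left_mult_bij_betw[OF inv_closed[OF g]],
        of "\<lambda>x. (cmod (f x))\<^sup>2"] by simp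
  then have "(\<lambda>x. (cmod (left_regular g f x))\<^sup>2) summable_on carrier G"
    using left_regular_apply[OF f] by (simp cong: summable_on_cong)
  then show ?thesis using left_regular_outside[OF f] by simp
qed

lemma left_regular_mult:
  assumes "g \<in> carrier G" "h \<in> carrier G" "f \<in> carrier (l2_space (carrier G))"
  shows "left_regular (g \<otimes> h) f = left_regular g (left_regular h f)"
proof
  fix x
  show "left_regular (g \<otimes> h) f x = left_regular g (left_regular h f) x"
    using assms left_regular_closed[of h f]
    by (cases "x \<in> carrier G")
       (simp_all add: left_regular_apply left_regular_outside inv_mult_group m_assoc del: l2_space_simps)
qed

lemma left_regular_one:
  assumes "f \<in> carrier (l2_space (carrier G))"
  shows "left_regular \<one> f = f"
proof
  fix x
  show "left_regular \<one> f x = f x"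
    using assms by (cases "x \<in> carrier G") (auto simp: left_regular_def)
qed

lemma unitary_rep_left_regular: "unitary_rep G (l2_space (carrier G)) left_regular"
proof -
  let ?H = "l2_space (carrier G)"
  have Bij: "left_regular g \<in> Bij (carrier ?H)" if g: "g \<in> carrier G" for g
  proof -
    have "bij_betw (left_regular g) (carrier ?H) (carrier ?H)"
    proof (rule bij_betw_byWitness[where f' = "left_regular (inv g)"])
      show "\<forall>f\<in>carrier ?H. left_regular (inv g) (left_regular g f) = f"
        using g left_regular_mult[of "inv g" g] left_regular_one by (simp del: l2_space_simps)
      show "\<forall>f\<in>carrier ?H. left_regular g (left_regular (inv g) f) = f"
        using g left_regular_mult[of g "inv g"] left_regular_one by (simp del: l2_space_simps)
    qed (use g left_regular_closed in auto)
    then show ?thesis by (simp add: Bij_def left_regular_def)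
  qed
  have act: "group_action G (carrier ?H) left_regular"
  proof (intro group_action.intro group_hom.intro group_hom_axioms.intro homI group_BijGroup)
    show "left_regular g \<in> carrier (BijGroup (carrier ?H))" if "g \<in> carrier G" for g
      using Bij[OF that] by (simp add: BijGroup_def)
    show "left_regular (g \<otimes> h) = left_regular g \<otimes>\<^bsub>BijGroup (carrier ?H)\<^esub> left_regular h"
      if "g \<in> carrier G" "h \<in> carrier G" for g h
    proof -
      have "left_regular (g \<otimes> h) = compose (carrier ?H) (left_regular g) (left_regular h)"
      proof (rule extensionalityI[where A = "carrier ?H"])
        show "left_regular (g \<otimes> h) \<in> extensional (carrier ?H)" by (simp add: left_regular_def)
        show "left_regular (g \<otimes> h) f = compose (carrier ?H) (left_regular g) (left_regular h) f"
          if "f \<in> carrier ?H" for f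
          using that left_regular_mult[OF \<open>g \<in> carrier G\<close> \<open>h \<in> carrier G\<close>, of f]
          by (simp add: compose_def)
      qed simp
      then show ?thesis using Bij that by (simp add: BijGroup_def)
    qed
  qed (rule is_group)
  show ?thesis
  proof (intro unitary_rep.intro is_group complex_hilbert_space_l2_space act unitary_rep_axioms.intro)
    fix g f h assume g: "g \<in> carrier G" and fh: "f \<in> carrier ?H" "h \<in> carrier ?H"
    show "left_regular g (f \<oplus>\<^bsub>?H\<^esub> h) = left_regular g f \<oplus>\<^bsub>?H\<^esub> left_regular g h"
      using fh summable_on_square_add[of f "carrier G" h] by (auto simp: left_regular_def)
    have "ip ?H (left_regular g f) (left_regular g h)
        = (\<Sum>\<^sub>\<infinity>x\<in>carrier G. cnj (f (inv g \<otimes> x)) * h (inv g \<otimes> x))"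
      unfolding l2_space_simps using fh by (intro infsum_cong) (simp add: left_regular_def)
    also have "\<dots> = ip ?H f h"
      using infsum_reindex_bij_betw[OF left_mult_bij_betw[OF inv_closed[OF g]],
          of "\<lambda>x. cnj (f x) * h x"] by simp
    finally show "ip ?H (left_regular g f) (left_regular g h) = ip ?H f h" .
  next
    fix g f c assume "g \<in> carrier G" "f \<in> carrier ?H"
    then show "left_regular g (c \<odot>\<^bsub>?H\<^esub> f) = c \<odot>\<^bsub>?H\<^esub> left_regular g f"
      using summable_on_square_smult[of f "carrier G" c] by (auto simp: left_regular_def)
  qed
qed

text \<open>Translation by \<open>x\<close> carries the value at the identity to \<open>x\<close>,
  so an invariant function is constant. A constant that is square summable over an infinite set is
  0.\<close>

lemma left_regular_no_invariant_vector:
  assumes inf: "infinite (carrier G)"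
  shows "\<not> has_invariant_vector G (l2_space (carrier G)) left_regular"
proof
  assume "has_invariant_vector G (l2_space (carrier G)) left_regular"
  then obtain f where f: "f \<in> carrier (l2_space (carrier G))" "f \<noteq> (\<lambda>_. 0)"
    and fix_f: "\<And>g. g \<in> carrier G \<Longrightarrow> left_regular g f = f"
    by (auto simp: has_invariant_vector_def)
  have const: "f x = f \<one>" if "x \<in> carrier G" for x
    using left_regular_apply[OF f(1) that, of x] fix_f[OF that] that by simp
  have "(\<lambda>x. (cmod (f x))\<^sup>2) summable_on carrier G
      \<longleftrightarrow> (\<lambda>_. (cmod (f \<one>))\<^sup>2) summable_on carrier G"
    by (rule summable_on_cong) (metis const)
  then have "(\<lambda>_. (cmod (f \<one>))\<^sup>2) summable_on carrier G" using f by simp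
  then have "f \<one> = 0" using infsum_diverge_constant[OF inf, of "(cmod (f \<one>))\<^sup>2"] by auto
  then have "f x = 0" for x using const[of x] f by (cases "x \<in> carrier G") auto
  then show False using f by blast
qed

text \<open>Testing the pair on the left regular representation reduces each upper bound to the
  choice of a real function \<open>\<phi>\<close> and an estimate of its displacement.\<close>

lemma kazhdan_pair_le_displacement:
  fixes \<phi> :: "'a \<Rightarrow> real"
  assumes kp: "kazhdan_pair G S \<epsilon>" and inf: "infinite (carrier G)"
    and sum: "(\<lambda>x. (\<phi> x)\<^sup>2) summable_on carrier G"
    and nz: "z \<in> carrier G" "\<phi> z \<noteq> 0"
    and c: "0 \<le> c"
    and disp: "\<And>g. g \<in> S \<Longrightarrow> (\<Sum>\<^sub>\<infinity>x\<in>carrier G. (\<phi> (inv g \<otimes> x) - \<phi> x)\<^sup>2)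
                 \<le> c\<^sup>2 * (\<Sum>\<^sub>\<infinity>x\<in>carrier G. (\<phi> x)\<^sup>2)"
  shows "\<epsilon> \<le> c"
proof -
  let ?H = "l2_space (carrier G)"
  define \<xi> where "\<xi> = (\<lambda>x. if x \<in> carrier G then complex_of_real (\<phi> x) else 0)"
  have "(\<lambda>x. (cmod (\<xi> x))\<^sup>2) summable_on carrier G"
    using sum by (simp add: \<xi>_def cong: summable_on_cong)
  then have \<xi>: "\<xi> \<in> carrier ?H" by (simp add: \<xi>_def)
  define M where "M = (\<Sum>\<^sub>\<infinity>x\<in>carrier G. (\<phi> x)\<^sup>2)"
  have n\<xi>: "hnorm ?H \<xi> = sqrt M"
    by (simp add: hnorm_l2_space M_def \<xi>_def cong: infsum_cong)
  have "(\<phi> z)\<^sup>2 \<le> M"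
    using finite_sum_le_infsum[OF sum, of "{z}"] nz by (simp add: M_def)
  then have M: "M > 0" using nz by (smt (verit) zero_less_power2)
  have S: "finite S" "S \<subseteq> carrier G"
    and K: "\<epsilon> * hnorm ?H \<xi> \<le> Max (insert 0 ((\<lambda>g. hnorm ?H (left_regular g \<xi> \<ominus>\<^bsub>?H\<^esub> \<xi>)) ` S))"
    using kp unitary_rep_left_regular left_regular_no_invariant_vector[OF inf] \<xi>
    by (auto simp: kazhdan_pair_def kazhdan_pair_in_def simp del: l2_space_simps)
  have "hnorm ?H (left_regular g \<xi> \<ominus>\<^bsub>?H\<^esub> \<xi>) \<le> c * sqrt M" if g: "g \<in> S" for g
  proof -
    have gG: "g \<in> carrier G" using g S by auto
    have "(\<Sum>\<^sub>\<infinity>x\<in>carrier G. (cmod (left_regular g \<xi> x - \<xi> x))\<^sup>2)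
        = (\<Sum>\<^sub>\<infinity>x\<in>carrier G. (\<phi> (inv g \<otimes> x) - \<phi> x)\<^sup>2)"
      using gG by (intro infsum_cong)
        (simp only: left_regular_apply[OF \<xi>], simp add: \<xi>_def flip: of_real_diff)
    also have "\<dots> \<le> c\<^sup>2 * M" using disp[OF g] by (simp add: M_def)
    finally have "hnorm ?H (left_regular g \<xi> \<ominus>\<^bsub>?H\<^esub> \<xi>) \<le> sqrt (c\<^sup>2 * M)"
      unfolding l2_space_minus[OF left_regular_closed[OF gG \<xi>] \<xi>] hnorm_l2_space
      by (rule real_sqrt_le_mono)
    then show ?thesis using c by (simp add: real_sqrt_mult)
  qed
  \<comment> \<open>Besides the displacements, the inserted 0 has to lie below
    \<open>c * sqrt M\<close>, which follows from \<open>0 \<le> c\<close>.\<close>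
  then have "Max (insert 0 ((\<lambda>g. hnorm ?H (left_regular g \<xi> \<ominus>\<^bsub>?H\<^esub> \<xi>)) ` S)) \<le> c * sqrt M"
    using S c M by (subst Max_le_iff) auto
  then have "\<epsilon> * sqrt M \<le> c * sqrt M" using K n\<xi> by simp
  then show ?thesis using M by simp
qed


section \<open>Two test vectors\<close>

text \<open>With value \<open>a\<close> at the identity and 1 on \<open>m\<close> other elements,
  the squared norm is \<open>a\<^sup>2 + m\<close> and the overlap with a translate by a nontrivial
  generator is at least \<open>2 * a\<close>. The ratio of these is largest at
  \<open>a = sqrt m\<close>.\<close>

lemma kazhdan_pair_le_star:
  assumes kp: "kazhdan_pair G S \<epsilon>" and inf: "infinite (carrier G)"
    and sym: "\<And>g. g \<in> S \<Longrightarrow> inv g \<in> S" and ne: "S - {\<one>} \<noteq> {}"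
  shows "\<epsilon> \<le> sqrt (2 - 2 / sqrt (card S))"
proof -
  have S: "finite S" "S \<subseteq> carrier G"
    using kp by (auto simp: kazhdan_pair_def kazhdan_pair_in_def)
  \<comment> \<open>The identity carries a value of its own, so it is kept out of \<open>T\<close>.
    The resulting bound in terms of \<open>m\<close> is relaxed to \<open>card S\<close> at the
    end.\<close>
  define T where "T = S - {\<one>}"
  define m where "m = real (card T)"
  have m1: "m \<ge> 1" using ne S by (simp add: m_def T_def Suc_le_eq card_gt_0_iff)
  have mS: "m \<le> card S" using S unfolding m_def T_def by (simp add: card_mono)
  define \<phi> where "\<phi> = (\<lambda>x. if x = \<one> then sqrt m else if x \<in> T then 1 else 0)"
  have TG: "T \<subseteq> carrier G" "finite T" "\<one> \<notin> T" using S by (auto simp: T_def)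
  have hs: "((\<lambda>x. (\<phi> x)\<^sup>2) has_sum (\<Sum>x\<in>insert \<one> T. (\<phi> x)\<^sup>2)) (carrier G)"
    by (rule has_sum_finite_neutralI[where B = "insert \<one> T"]) (use TG in \<open>auto simp: \<phi>_def\<close>)
  have "(\<Sum>x\<in>T. (\<phi> x)\<^sup>2) = (\<Sum>x\<in>T. 1)"
    using TG by (intro sum.cong) (auto simp: \<phi>_def)
  then have "(\<Sum>x\<in>insert \<one> T. (\<phi> x)\<^sup>2) = 2 * m"
    using TG m1 by (simp add: \<phi>_def m_def)
  then have hs: "((\<lambda>x. (\<phi> x)\<^sup>2) has_sum 2 * m) (carrier G)" using hs by simp
  have norm: "(\<Sum>\<^sub>\<infinity>x\<in>carrier G. (\<phi> x)\<^sup>2) = 2 * m" using hs by (rule infsumI)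
  have sum: "(\<lambda>x. (\<phi> x)\<^sup>2) summable_on carrier G" using hs by (rule has_sum_imp_summable)
  define c where "c = sqrt (2 - 2 / sqrt m)"
  have r: "2 / sqrt m \<le> 2" using m1 by (simp add: divide_le_eq)
  then have c2: "c\<^sup>2 = 2 - 2 / sqrt m" by (simp add: c_def)
  have "\<epsilon> \<le> c"
  proof (rule kazhdan_pair_le_displacement[OF kp inf sum])
    show "\<one> \<in> carrier G" "\<phi> \<one> \<noteq> 0" using m1 by (auto simp: \<phi>_def)
    show "0 \<le> c" using r by (simp add: c_def)
  next
    fix g assume g: "g \<in> S"
    then have gG: "g \<in> carrier G" using S by auto
    show "(\<Sum>\<^sub>\<infinity>x\<in>carrier G. (\<phi> (inv g \<otimes> x) - \<phi> x)\<^sup>2) \<le> c\<^sup>2 * (\<Sum>\<^sub>\<infinity>x\<in>carrier G. (\<phi> x)\<^sup>2)"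
    \<comment> \<open>The set \<open>S\<close> may contain the identity, which moves nothing; for
      any other \<open>g\<close>, the points \<open>\<one>\<close> and \<open>g\<close> of overlap
      are distinct.\<close>
    proof (cases "g = \<one>")
      case True
      then have "(\<Sum>\<^sub>\<infinity>x\<in>carrier G. (\<phi> (inv g \<otimes> x) - \<phi> x)\<^sup>2) = (\<Sum>\<^sub>\<infinity>x\<in>carrier G. 0)"
        by (intro infsum_cong) simp
      then show ?thesis using norm m1 by simp
    next
      case False
      have gT: "g \<in> T" "inv g \<in> T"
        using False g gG sym by (auto simp: T_def inv_eq_1_iff)
      note bij = left_mult_bij_betw[OF inv_closed[OF gG]]
      have hs': "((\<lambda>x. (\<phi> (inv g \<otimes> x))\<^sup>2) has_sum 2 * m) (carrier G)"
        using hs has_sum_reindex_bij_betw[OF bij, of "\<lambda>x. (\<phi> x)\<^sup>2"] by simp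
      \<comment> \<open>The second factor confines the product to \<open>insert \<one> T\<close>, so
        the cross term is a finite sum.\<close>
      have pair: "((\<lambda>x. \<phi> (inv g \<otimes> x) * \<phi> x) has_sum
          (\<Sum>x\<in>insert \<one> T. \<phi> (inv g \<otimes> x) * \<phi> x)) (carrier G)"
        by (rule has_sum_finite_neutralI[where B = "insert \<one> T"]) (use TG in \<open>auto simp: \<phi>_def\<close>)
      \<comment> \<open>Symmetry enters here: at \<open>\<one>\<close> the product is
        \<open>1 * sqrt m\<close> because \<open>inv g\<close> lies in \<open>T\<close>, and at
        \<open>g\<close> it is \<open>sqrt m * 1\<close>.\<close>
      have "2 * sqrt m = (\<Sum>x\<in>{\<one>, g}. \<phi> (inv g \<otimes> x) * \<phi> x)"
        using False gT gG TG by (auto simp: \<phi>_def)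
      also have "\<dots> \<le> (\<Sum>x\<in>insert \<one> T. \<phi> (inv g \<otimes> x) * \<phi> x)"
        using gT TG m1 by (intro sum_mono2) (auto simp: \<phi>_def)
      finally have P: "2 * sqrt m \<le> (\<Sum>x\<in>insert \<one> T. \<phi> (inv g \<otimes> x) * \<phi> x)" (is "_ \<le> ?P") .
      have "((\<lambda>x. (\<phi> (inv g \<otimes> x))\<^sup>2 + (\<phi> x)\<^sup>2 + - 2 * (\<phi> (inv g \<otimes> x) * \<phi> x)) has_sum
          (2 * m + 2 * m + - 2 * ?P)) (carrier G)"
        by (intro has_sum_add has_sum_cmult_right hs hs' pair)
      then have "(\<Sum>\<^sub>\<infinity>x\<in>carrier G. (\<phi> (inv g \<otimes> x) - \<phi> x)\<^sup>2) = 4 * m - 2 * ?P"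
        by (intro infsumI) (simp add: power2_diff algebra_simps)
      also have "\<dots> \<le> 4 * m - 4 * sqrt m" using P by simp
      also have "\<dots> = 4 * m - 4 * (m / sqrt m)" using m1 by (simp add: real_div_sqrt)
      also have "\<dots> = c\<^sup>2 * (2 * m)" by (simp add: c2 left_diff_distrib)
      finally show ?thesis using norm by simp
    qed
  qed
  also have "c \<le> sqrt (2 - 2 / sqrt (card S))"
    unfolding c_def using m1 mS by (intro real_sqrt_le_mono diff_left_mono frac_le) auto
  finally show ?thesis .
qed

end

section \<open>Comparing a difference with a difference of logarithms\<close>

lemma sinh_le_mult_cosh:
  fixes t :: real
  assumes "0 \<le> t"
  shows "sinh t \<le> t * cosh t"
proof -
  \<comment> \<open>This function vanishes at 0 and has the derivative \<open>x * sinh x\<close>,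
    which is nonnegative for \<open>x \<ge> 0\<close>.\<close>
  have "(\<lambda>t. t * cosh t - sinh t) 0 \<le> (\<lambda>t. t * cosh t - sinh t) t"
  proof (rule DERIV_nonneg_imp_nondecreasing[OF assms])
    fix x :: real assume "0 \<le> x"
    have "((\<lambda>t. t * cosh t - sinh t) has_real_derivative x * sinh x) (at x)"
      by (auto intro!: derivative_eq_intros)
    then show "\<exists>y. ((\<lambda>t. t * cosh t - sinh t) has_real_derivative y) (at x) \<and> 0 \<le> y"
      using \<open>0 \<le> x\<close> by auto
  qed
  then show ?thesis by simp
qed

text \<open>With \<open>u = r e\<^sup>t\<close> and \<open>v = r e\<^sup>-\<^sup>t\<close>, this is \<open>sinh\<^sup>2 t \<le> t\<^sup>2 cosh (2 t)\<close>.\<close>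

lemma diff_square_le_ln:
  fixes u v :: real
  assumes "u > 0" "v > 0"
  shows "(u - v)\<^sup>2 \<le> (ln u - ln v)\<^sup>2 * ((u\<^sup>2 + v\<^sup>2) / 2)"
proof -
  define r where "r = exp ((ln u + ln v) / 2)"
  define t where "t = (ln u - ln v) / 2"
  have "u = r * exp t" "v = r * exp (- t)"
    using assms by (simp_all add: r_def t_def field_simps flip: exp_add)
  then have uv: "u - v = r * (2 * sinh t)" "u\<^sup>2 + v\<^sup>2 = r\<^sup>2 * (2 * cosh (2 * t))"
    by (simp_all add: sinh_def cosh_def algebra_simps power_mult_distrib flip: exp_double)
  \<comment> \<open>The sign of \<open>t\<close> is unknown and disappears on squaring.\<close>
  have "sinh \<bar>t\<bar> \<le> \<bar>t\<bar> * cosh \<bar>t\<bar>" by (rule sinh_le_mult_cosh) simp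
  then have "(sinh \<bar>t\<bar>)\<^sup>2 \<le> (\<bar>t\<bar> * cosh \<bar>t\<bar>)\<^sup>2" by (intro power_mono) auto
  then have "(sinh t)\<^sup>2 \<le> t\<^sup>2 * (cosh t)\<^sup>2" by (simp add: power_mult_distrib abs_if split: if_splits)
  \<comment> \<open>Since \<open>cosh (2 * t)\<close> is the sum of the squares of
    \<open>cosh t\<close> and \<open>sinh t\<close>, it is at least
    \<open>(cosh t)\<^sup>2\<close>.\<close>
  also have "\<dots> \<le> t\<^sup>2 * cosh (2 * t)"
    by (intro mult_left_mono) (auto simp: cosh_double)
  finally have "r\<^sup>2 * (4 * (sinh t)\<^sup>2) \<le> r\<^sup>2 * (4 * (t\<^sup>2 * cosh (2 * t)))"
    by (intro mult_left_mono) auto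
  moreover have "ln u - ln v = 2 * t" by (simp add: t_def)
  ultimately show ?thesis unfolding uv by (simp add: power_mult_distrib algebra_simps)
qed

section \<open>Word length and the logarithmic bound\<close>

context Group.group
begin

text \<open>Words have exactly \<open>k\<close> letters, not at most \<open>k\<close>, which gives
  the count \<open>card S ^ k\<close> directly. Inverses of letters are not added; symmetry of
  \<open>S\<close> supplies them later.\<close>

fun word_products :: "'a set \<Rightarrow> nat \<Rightarrow> 'a set" where
  "word_products S 0 = {\<one>}"
| "word_products S (Suc k) = (\<lambda>(g, x). g \<otimes> x) ` (S \<times> word_products S k)"

lemma finite_word_products: "finite S \<Longrightarrow> finite (word_products S k)"
  by (induction k) auto

lemma card_word_products: "finite S \<Longrightarrow> card (word_products S k) \<le> card S ^ k"
proof (induction k)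
  case (Suc k)
  have "card (word_products S (Suc k)) \<le> card (S \<times> word_products S k)"
    unfolding word_products.simps
    using Suc.prems finite_word_products by (intro card_image_le finite_cartesian_product)
  also have "\<dots> \<le> card S * card S ^ k" using Suc by (simp add: card_cartesian_product)
  finally show ?case by simp
qed simp

lemma word_products_closed: "\<lbrakk>S \<subseteq> carrier G; x \<in> word_products S k\<rbrakk> \<Longrightarrow> x \<in> carrier G"
  by (induction k arbitrary: x) auto

lemma word_products_mult:
  "\<lbrakk>S \<subseteq> carrier G; x \<in> word_products S j; y \<in> word_products S k\<rbrakk>
   \<Longrightarrow> x \<otimes> y \<in> word_products S (j + k)"
proof (induction j arbitrary: x)
  case 0
  then show ?case using word_products_closed by simp
next
  case (Suc j)
  then obtain g x' where x': "g \<in> S" "x' \<in> word_products S j" "x = g \<otimes> x'" by auto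
  have "x \<otimes> y = g \<otimes> (x' \<otimes> y)"
    using x' Suc.prems word_products_closed by (simp add: m_assoc subset_iff)
  then show ?case using x' Suc.IH[OF Suc.prems(1) x'(2) Suc.prems(3)] by auto
qed

text \<open>A symmetric set already contains the inverses that \<open>generate\<close> adds, and
  concatenation of words covers products.\<close>

lemma generate_word_products:
  assumes S: "S \<subseteq> carrier G" and sym: "\<And>g. g \<in> S \<Longrightarrow> inv g \<in> S"
    and x: "x \<in> generate G S"
  shows "\<exists>k. x \<in> word_products S k"
proof -
  have one: "g \<in> word_products S 1" if "g \<in> S" for g
    using that S by (force simp: image_iff)
  from x show ?thesis
  proof induction
    case one
    have "\<one> \<in> word_products S 0" by simp
    then show ?case ..
  next
    case (eng a b)
    then show ?case using word_products_mult[OF S] by blast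
  qed (use one sym in blast)+
qed

text \<open>For an element that is no word in \<open>S\<close> the \<open>LEAST\<close> has no
  useful value; the lemmas about it therefore assume membership in some
  \<open>word_products S k\<close>.\<close>

definition word_length :: "'a set \<Rightarrow> 'a \<Rightarrow> nat" where
  "word_length S x = (LEAST k. x \<in> word_products S k)"

lemma word_products_word_length:
  "x \<in> word_products S k \<Longrightarrow> x \<in> word_products S (word_length S x)"
  unfolding word_length_def by (rule LeastI)

lemma word_length_mult_le:
  assumes "g \<in> S" "x \<in> word_products S k"
  shows "word_length S (g \<otimes> x) \<le> Suc (word_length S x)"
proof -
  have "g \<otimes> x \<in> word_products S (Suc (word_length S x))"
    using assms word_products_word_length by auto
  then show ?thesis unfolding word_length_def[of S "g \<otimes> x"] by (rule Least_le)
qed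

text \<open>At most \<open>card S ^ k\<close> elements have length \<open>k\<close>, so every finite
  sum is bounded by the geometric series with ratio \<open>card S * q\<close>.\<close>

lemma summable_on_power_word_length:
  fixes q :: real
  assumes S: "finite S" "\<And>x. x \<in> A \<Longrightarrow> \<exists>k. x \<in> word_products S k"
    and q: "0 \<le> q" "card S * q < 1"
  shows "(\<lambda>x. q ^ word_length S x) summable_on A"
proof (rule nonneg_bdd_above_summable_on[OF _ bdd_aboveI2])
  fix F assume F: "F \<in> {F. F \<subseteq> A \<and> finite F}"
  define p where "p = card S * q"
  have p: "0 \<le> p" "p < 1" using q by (auto simp: p_def)
  \<comment> \<open>\<open>K\<close> bounds the lengths in \<open>F\<close>, so that
    \<open>F\<close> splits into finitely many spheres; the 0 covers empty \<open>F\<close>.\<close>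
  define K where "K = Max (insert 0 (word_length S ` F))"
  have sphere: "(\<Sum>x\<in>{x \<in> F. word_length S x = k}. q ^ word_length S x) \<le> p ^ k" for k
  proof -
    have "{x \<in> F. word_length S x = k} \<subseteq> word_products S k"
      using F S(2) word_products_word_length by blast
    then have "card {x \<in> F. word_length S x = k} \<le> card S ^ k"
      using card_mono[OF finite_word_products[OF S(1)]] card_word_products[OF S(1)] le_trans by blast
    then have "card {x \<in> F. word_length S x = k} * q ^ k \<le> real (card S ^ k) * q ^ k"
      using q by (intro mult_right_mono) (simp_all only: of_nat_le_iff zero_le_power)
    then show ?thesis by (simp add: p_def power_mult_distrib)
  qed
  have "sum (\<lambda>x. q ^ word_length S x) F
      = (\<Sum>k\<le>K. \<Sum>x\<in>{x \<in> F. word_length S x = k}. q ^ word_length S x)"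
    using F by (intro sum.group[symmetric]) (auto simp: K_def)
  also have "\<dots> \<le> (\<Sum>k\<le>K. p ^ k)" by (intro sum_mono sphere)
  also have "\<dots> \<le> (\<Sum>k. p ^ k)" using p by (intro sum_le_suminf) (auto intro: summable_geometric)
  finally show "sum (\<lambda>x. q ^ word_length S x) F \<le> (\<Sum>k. p ^ k)" .
qed (use q in auto)

text \<open>The condition \<open>lam > card S\<close> makes
  \<open>(1 / lam) ^ word_length S x\<close>, the square of the test vector, summable. Slower decay
  gives a smaller bound, so the useful values lie just above \<open>card S\<close>.\<close>

lemma kazhdan_pair_le_ln:
  fixes lam :: real
  assumes kp: "kazhdan_pair G S \<epsilon>" and inf: "infinite (carrier G)"
    and sym: "\<And>g. g \<in> S \<Longrightarrow> inv g \<in> S" and gen: "generate G S = carrier G"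
    and lam: "lam > card S" "lam \<ge> 1"
  shows "\<epsilon> \<le> ln lam / 2"
proof -
  have S: "finite S" "S \<subseteq> carrier G"
    using kp by (auto simp: kazhdan_pair_def kazhdan_pair_in_def)
  have wp: "\<exists>k. x \<in> word_products S k" if "x \<in> carrier G" for x
    using generate_word_products[OF S(2) sym] that gen by blast
  define \<phi> where "\<phi> = (\<lambda>x. (1 / sqrt lam) ^ word_length S x)"
  have pos: "\<phi> x > 0" for x using lam by (simp add: \<phi>_def)
  have ln\<phi>: "ln (\<phi> x) = - (word_length S x * (ln lam / 2))" for x
    using lam by (simp add: \<phi>_def ln_realpow ln_div ln_sqrt)
  have "(\<phi> x)\<^sup>2 = (1 / lam) ^ word_length S x" for x
    using lam by (simp add: \<phi>_def power_divide flip: power_mult) (simp add: mult.commute power_mult)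
  moreover have "(\<lambda>x. (1 / lam) ^ word_length S x) summable_on carrier G"
    using lam S wp by (intro summable_on_power_word_length) auto
  ultimately have sum: "(\<lambda>x. (\<phi> x)\<^sup>2) summable_on carrier G" by simp
  show ?thesis
  proof (rule kazhdan_pair_le_displacement[OF kp inf sum])
    show "\<one> \<in> carrier G" "\<phi> \<one> \<noteq> 0" using pos[of \<one>] by auto
    show c: "0 \<le> ln lam / 2" using lam by simp
    fix g assume g: "g \<in> S"
    then have gG: "g \<in> carrier G" using S by auto
    define c where "c = ln lam / 2"
    note bij = left_mult_bij_betw[OF inv_closed[OF gG]]
    have sum': "(\<lambda>x. (\<phi> (inv g \<otimes> x))\<^sup>2) summable_on carrier G"
      using sum summable_on_reindex_bij_betw[OF bij, of "\<lambda>x. (\<phi> x)\<^sup>2"] by simp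
    have le: "(\<phi> (inv g \<otimes> x) - \<phi> x)\<^sup>2 \<le> c\<^sup>2 / 2 * ((\<phi> (inv g \<otimes> x))\<^sup>2 + (\<phi> x)\<^sup>2)"
      if x: "x \<in> carrier G" for x
    proof -
      \<comment> \<open>Lengths differ by at most 1 because \<open>inv g\<close>, in
        \<open>S\<close> by symmetry, leads from \<open>x\<close> to its translate, and
        \<open>g\<close> leads back.\<close>
      have "word_length S (inv g \<otimes> x) \<le> Suc (word_length S x)"
        using word_length_mult_le[OF sym[OF g]] wp[OF x] by blast
      moreover have "word_length S x \<le> Suc (word_length S (inv g \<otimes> x))"
      proof -
        have "g \<otimes> (inv g \<otimes> x) = x" using gG x by (simp add: m_assoc[symmetric])
        then show ?thesis using word_length_mult_le[OF g] wp[of "inv g \<otimes> x"] gG x by fastforce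
      qed
      ultimately have d: "\<bar>real (word_length S x) - real (word_length S (inv g \<otimes> x))\<bar> \<le> 1" by simp
      have "ln (\<phi> (inv g \<otimes> x)) - ln (\<phi> x)
          = (real (word_length S x) - real (word_length S (inv g \<otimes> x))) * c"
        by (simp add: ln\<phi> c_def algebra_simps)
      then have "\<bar>ln (\<phi> (inv g \<otimes> x)) - ln (\<phi> x)\<bar>
          = \<bar>real (word_length S x) - real (word_length S (inv g \<otimes> x))\<bar> * c"
        using c by (simp only: abs_mult) (simp add: c_def)
      also have "\<dots> \<le> 1 * c" using d c by (intro mult_right_mono) (auto simp: c_def)
      finally have "(ln (\<phi> (inv g \<otimes> x)) - ln (\<phi> x))\<^sup>2 \<le> c\<^sup>2"
        using c by (subst power2_le_iff_abs_le) (auto simp: c_def)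
      then have "(ln (\<phi> (inv g \<otimes> x)) - ln (\<phi> x))\<^sup>2 * (((\<phi> (inv g \<otimes> x))\<^sup>2 + (\<phi> x)\<^sup>2) / 2)
          \<le> c\<^sup>2 * (((\<phi> (inv g \<otimes> x))\<^sup>2 + (\<phi> x)\<^sup>2) / 2)"
        by (intro mult_right_mono) auto
      then show ?thesis
        using diff_square_le_ln[OF pos pos, of "inv g \<otimes> x" x] by simp
    qed
    have R: "(\<lambda>x. c\<^sup>2 / 2 * ((\<phi> (inv g \<otimes> x))\<^sup>2 + (\<phi> x)\<^sup>2)) summable_on carrier G"
      by (intro summable_on_cmult_right summable_on_add sum sum')
    have "(\<Sum>\<^sub>\<infinity>x\<in>carrier G. (\<phi> (inv g \<otimes> x) - \<phi> x)\<^sup>2)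
        \<le> (\<Sum>\<^sub>\<infinity>x\<in>carrier G. c\<^sup>2 / 2 * ((\<phi> (inv g \<otimes> x))\<^sup>2 + (\<phi> x)\<^sup>2))"
      by (rule infsum_mono[OF summable_on_comparison_test[OF R] R]) (use le in simp_all)
    also have "\<dots> = c\<^sup>2 / 2 * ((\<Sum>\<^sub>\<infinity>x\<in>carrier G. (\<phi> (inv g \<otimes> x))\<^sup>2) + (\<Sum>\<^sub>\<infinity>x\<in>carrier G. (\<phi> x)\<^sup>2))"
      by (simp only: infsum_cmult_right' infsum_add[OF sum' sum])
    \<comment> \<open>Translation preserves the sum of squares, so the two equal halves cancel the
      denominator in \<open>c\<^sup>2 / 2\<close>.\<close>
    also have "(\<Sum>\<^sub>\<infinity>x\<in>carrier G. (\<phi> (inv g \<otimes> x))\<^sup>2) = (\<Sum>\<^sub>\<infinity>x\<in>carrier G. (\<phi> x)\<^sup>2)"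
      by (rule infsum_reindex_bij_betw[OF bij])
    finally show "(\<Sum>\<^sub>\<infinity>x\<in>carrier G. (\<phi> (inv g \<otimes> x) - \<phi> x)\<^sup>2)
        \<le> (ln lam / 2)\<^sup>2 * (\<Sum>\<^sub>\<infinity>x\<in>carrier G. (\<phi> x)\<^sup>2)"
      by (simp add: c_def)
  qed
qed

end


section \<open>The bound for orderable groups\<close>

text \<open>Some \<open>b\<close> lies above the identity, and left invariance then puts
  \<open>m \<otimes> b\<close> above every \<open>m\<close>. A nonempty finite strict order would
  have a maximal element.\<close>

lemma orderable_group_infinite:
  fixes G :: "('g, 'b) monoid_scheme"
  assumes ord: "orderable_group G" and nt: "carrier G \<noteq> {\<one>\<^bsub>G\<^esub>}"
  shows "infinite (carrier G)"
proof
  assume fin: "finite (carrier G)"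
  interpret Group.group G using ord by (simp add: orderable_group_def)
  obtain r where r: "trans r" "irrefl r" "total_on (carrier G) r"
    and inv: "\<And>f g h. \<lbrakk>f \<in> carrier G; g \<in> carrier G; h \<in> carrier G; (g, f) \<in> r\<rbrakk>
                \<Longrightarrow> (h \<otimes>\<^bsub>G\<^esub> g, h \<otimes>\<^bsub>G\<^esub> f) \<in> r"
    using ord by (auto simp: orderable_group_def strict_linear_order_on_def)
  obtain a where a: "a \<in> carrier G" "a \<noteq> \<one>\<^bsub>G\<^esub>" using nt by auto
  \<comment> \<open>If \<open>a\<close> lies below the identity, left multiplication by its inverse
    puts that inverse above the identity.\<close>
  obtain b where b: "b \<in> carrier G" "(\<one>\<^bsub>G\<^esub>, b) \<in> r"
  proof (cases "(\<one>\<^bsub>G\<^esub>, a) \<in> r")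
    case False
    then have "(a, \<one>\<^bsub>G\<^esub>) \<in> r" using r(3) a by (auto simp: total_on_def)
    then have "(\<one>\<^bsub>G\<^esub>, inv\<^bsub>G\<^esub> a) \<in> r" using inv[of "\<one>\<^bsub>G\<^esub>" a "inv\<^bsub>G\<^esub> a"] a by simp
    then show ?thesis using that a by blast
  qed (use that a in blast)
  \<comment> \<open>The relation \<open>r\<close> may contain pairs outside the carrier; its
    restriction is finite, so the converse is well-founded and a minimal element for it is maximal
    in the order.\<close>
  define s where "s = r \<inter> carrier G \<times> carrier G"
  have "trans s" using r(1) by (auto simp: s_def trans_def)
  moreover have "irrefl s" using r(2) by (auto simp: s_def irrefl_def)
  ultimately have "acyclic s" by (simp add: acyclic_irrefl)
  moreover have "finite s" using fin by (simp add: s_def)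
  ultimately have "wf (s\<inverse>)" by (simp add: finite_acyclic_wf_converse)
  then obtain m where m: "m \<in> carrier G" "\<forall>y. (y, m) \<in> s\<inverse> \<longrightarrow> y \<notin> carrier G"
    by (rule wfE_min[OF _ a(1)]) blast
  have "(m, m \<otimes>\<^bsub>G\<^esub> b) \<in> s" using inv[of b "\<one>\<^bsub>G\<^esub>" m] b m(1) by (simp add: s_def)
  then show False using m(2)[rule_format, of "m \<otimes>\<^bsub>G\<^esub> b"] m(1) b(1) by simp
qed

theorem mainTheorem3:
  fixes G :: "('g, 'b) monoid_scheme" and S :: "'g set"
  assumes "orderable_group G"
    and "carrier G \<noteq> {\<one>\<^bsub>G\<^esub>}"
    and "property_T G"
    and "finite S"
    and "symmetric_subset G S"
    and "generating_set G S"
  shows "kazhdan_const G S \<le> ereal (Phi_inv (real (card S)))"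
proof -
  interpret Group.group G using assms(1) by (simp add: orderable_group_def)
  have inf: "infinite (carrier G)" by (rule orderable_group_infinite[OF assms(1,2)])
  have gen: "S \<subseteq> carrier G" "generate G S = carrier G"
    using assms(6) by (auto simp: generating_set_def)
  have sym: "inv\<^bsub>G\<^esub> g \<in> S" if "g \<in> S" for g
    using assms(5) that by (auto simp: symmetric_subset_def SET_INV_def)
  \<comment> \<open>Without a generator other than the identity, the first test vector would be
    0.\<close>
  have ne: "S - {\<one>\<^bsub>G\<^esub>} \<noteq> {}"
  proof
    assume "S - {\<one>\<^bsub>G\<^esub>} = {}"
    then have "S \<subseteq> {\<one>\<^bsub>G\<^esub>}" by auto
    then have "generate G S \<subseteq> {\<one>\<^bsub>G\<^esub>}"
      using mono_generate generate_one by metis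
    then show False using gen inf by (metis finite.emptyI finite_insert finite_subset)
  qed
  define n where "n = real (card S)"
  have "S \<noteq> {}" using ne by blast
  then have n1: "n \<ge> 1" using assms(4) by (simp add: n_def Suc_le_eq card_gt_0_iff)
  have "\<epsilon> \<le> Phi_inv n" if kp: "kazhdan_pair G S \<epsilon>" for \<epsilon>
  proof -
    have "\<epsilon> \<le> ln n / 2"
    \<comment> \<open>Summability of the second test vector was secured for \<open>lam > n\<close>
      only, so the bound at \<open>n\<close> is reached as a limit from the right.\<close>
    proof (rule tendsto_lowerbound)
      show "((\<lambda>lam. ln lam / 2) \<longlongrightarrow> ln n / 2) (at_right n)"
        using n1 by (intro tendsto_intros) auto
      show "\<forall>\<^sub>F lam in at_right n. \<epsilon> \<le> ln lam / 2"
        using kazhdan_pair_le_ln[OF kp inf sym gen(2)] n1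
        by (auto simp: eventually_at_filter n_def)
    qed simp
    moreover have "\<epsilon> \<le> sqrt (2 - 2 / sqrt n)"
      using kazhdan_pair_le_star[OF kp inf sym ne] by (simp add: n_def)
    \<comment> \<open>This matches the second entry of the minimum in
      \<open>Phi_inv_explicit\<close>; the logarithmic bound is the first.\<close>
    moreover have "sqrt (2 - 2 / sqrt n) = sqrt 2 * sqrt (1 - n powr (-1/2))"
      using n1 by (simp add: powr_minus_divide powr_half_sqrt right_diff_distrib flip: real_sqrt_mult)
    ultimately show ?thesis by (simp add: Phi_inv_explicit[OF n1])
  qed
  then show ?thesis
    unfolding kazhdan_const_def n_def[symmetric] by (intro Sup_least) auto
qed

end
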